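(* Let $r$ be a positive integer and let $G_1,\dots,G_m$, $H_1,\dots,H_m$ and $G$ be graphs. If $H_i$ has zero $G_i$-slice density for each $i\in[m]$ and $G\xrightarrow{r}\{G_1,\dots,G_m\}$, then $G^{\square N}\xrightarrow{r}\{H_1,\dots,H_m\}$ for every sufficiently large integer $N$. Similarly, if $H_i$ has zero induced $G_i$-slice density for each $i\in[m]$ and $G\xrightarrow{r}_{\mathrm{ind}}\{G_1,\dots,G_m\}$, then $G^{\square N}\xrightarrow{r}_{\mathrm{ind}}\{H_1,\dots,H_m\}$ for every sufficiently large integer $N$.
   Context: Graphs are finite. The Cartesian product $G\square H$ has vertex set $V(G)\times V(H)$, with $(x_1,x_2)(y_1,y_2)$ an edge iff either $x_1y_1\in E(G)$ and $x_2=y_2$, or $x_1=y_1$ and $x_2y_2\in E(H)$; $G^{\square 1}=G$ and $G^{\square N}=G^{\square (N-1)}\square G$. A $G$-slice of $G^{\square N}$ is a subgraph induced by a Cartesian product of $V(G)$ and $N-1$ one-element subsets of $V(G)$, in any order of the coordinates (there are $N|V(G)|^{N-1}$ of them). A graph $H$ has zero (induced) $G$-slice density if for every $\varepsilon>0$ there is $N_0$ such that for every $N\geq N_0$, every subgraph of $G^{\square N}$ that contains at least an $\varepsilon$-fraction of the $G$-slices of $G^{\square N}$ contains an (induced) copy of $H$. For a graph $G$, a family $\mathcal F$ of graphs and a positive integer $r$, $G\xrightarrow{r}\mathcal F$ (resp. $G\xrightarrow{r}_{\mathrm{ind}}\mathcal F$) means that every $r$-coloring of $V(G)$ contains a monochromatic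 copy (resp. induced copy) of some graph in $\mathcal F$. *)

theory Defs
  imports Complex_Main "HOL-Library.FuncSet" "Graph_Theory.Graph_Theory"
begin

text \<open>
  Finite simple graphs are the finite, symmetric, loop-free digraphs without parallel arcs,
  \<^locale>\<open>pair_graph\<close>. The graph with no vertices is allowed.
\<close>

definition cart_prod ::
  "'a pair_pre_digraph \<Rightarrow> 'b pair_pre_digraph \<Rightarrow> ('a \<times> 'b) pair_pre_digraph" where
  "cart_prod G H =
     \<lparr> pverts = pverts G \<times> pverts H,
       parcs = {((x1, x2), (y1, y2)) | x1 x2 y1 y2.
                  (x1, y1) \<in> parcs G \<and> x2 = y2 \<and> x2 \<in> pverts H \<or>
                  x1 = y1 \<and> x1 \<in> pverts G \<and> (x2, y2) \<in> parcs H} \<rparr>"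

definition relabel :: "('a \<Rightarrow> 'b) \<Rightarrow> 'a pair_pre_digraph \<Rightarrow> 'b pair_pre_digraph" where
  "relabel f G = \<lparr> pverts = f ` pverts G, parcs = map_prod f f ` parcs G \<rparr>"

text \<open>
  The vertices of the \<open>N\<close>-th Cartesian power are the lists of length \<open>N\<close> over the vertices of \<open>G\<close>,
  so that all powers live on one type. The recursion starts with the one-vertex graph at exponent 0;
  the first power is then \<open>G\<close> on one-element lists.
\<close>

primrec cart_power :: "'a pair_pre_digraph \<Rightarrow> nat \<Rightarrow> 'a list pair_pre_digraph" where
  "cart_power G 0 = \<lparr> pverts = {[]}, parcs = {} \<rparr>"
| "cart_power G (Suc N) = relabel (\<lambda>(xs, x). xs @ [x]) (cart_prod (cart_power G N) G)"

text \<open>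
  The lists \<open>us\<close> and \<open>vs\<close> hold the \<open>N - 1\<close> fixed coordinates before and after the free one.
  Slices are collected as a set of subgraphs; if \<open>G\<close> has just one vertex, they all coincide, which
  does not affect the fraction of slices contained in a subgraph.
\<close>

definition slices ::
  "'a pair_pre_digraph \<Rightarrow> nat \<Rightarrow> ('a list, 'a list \<times> 'a list) pre_digraph set" where
  "slices G N =
     {with_proj (cart_power G N) \<restriction> ((\<lambda>x. us @ x # vs) ` pverts G) | us vs.
        set us \<subseteq> pverts G \<and> set vs \<subseteq> pverts G \<and> length us + length vs + 1 = N}"

definition is_copy ::
  "'a pair_pre_digraph \<Rightarrow> 'b pair_pre_digraph \<Rightarrow> 'a pair_pre_digraph \<Rightarrow> bool" where
  "is_copy C H G \<longleftrightarrow> subgraph C G \<and> digraph_iso H C"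

definition is_induced_copy ::
  "'a pair_pre_digraph \<Rightarrow> 'b pair_pre_digraph \<Rightarrow> 'a pair_pre_digraph \<Rightarrow> bool" where
  "is_induced_copy C H G \<longleftrightarrow> induced_subgraph C G \<and> digraph_iso H C"

definition contains_slice_fraction ::
  "real \<Rightarrow> 'a pair_pre_digraph \<Rightarrow> nat \<Rightarrow> 'a list pair_pre_digraph \<Rightarrow> bool" where
  "contains_slice_fraction \<epsilon> G N K \<longleftrightarrow>
     \<epsilon> * real (card (slices G N)) \<le> real (card {S \<in> slices G N. subgraph S K})"

text \<open>
  The condition \<open>pair_graph K\<close> makes \<open>K\<close> an undirected subgraph: the library notion
  \<^const>\<open>subgraph\<close> on its own would also admit subdigraphs that are not symmetric.
\<close>

definition zero_slice_density :: "'a pair_pre_digraph \<Rightarrow> 'b pair_pre_digraph \<Rightarrow> bool" where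
  "zero_slice_density G H \<longleftrightarrow>
     (\<forall>\<epsilon>>0. \<exists>N0. \<forall>N\<ge>N0. \<forall>K.
        pair_graph K \<and> subgraph K (cart_power G N) \<and> contains_slice_fraction \<epsilon> G N K \<longrightarrow>
        (\<exists>C. is_copy C H K))"

definition zero_induced_slice_density :: "'a pair_pre_digraph \<Rightarrow> 'b pair_pre_digraph \<Rightarrow> bool" where
  "zero_induced_slice_density G H \<longleftrightarrow>
     (\<forall>\<epsilon>>0. \<exists>N0. \<forall>N\<ge>N0. \<forall>K.
        pair_graph K \<and> subgraph K (cart_power G N) \<and> contains_slice_fraction \<epsilon> G N K \<longrightarrow>
        (\<exists>C. is_induced_copy C H K))"

definition arrows :: "nat \<Rightarrow> 'a pair_pre_digraph \<Rightarrow> 'b pair_pre_digraph set \<Rightarrow> bool" where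
  "arrows r G F \<longleftrightarrow>
     (\<forall>c \<in> pverts G \<rightarrow> {1..r}. \<exists>H\<in>F. \<exists>C. is_copy C H G \<and>
        (\<exists>k\<in>{1..r}. \<forall>v\<in>pverts C. c v = k))"

definition induced_arrows :: "nat \<Rightarrow> 'a pair_pre_digraph \<Rightarrow> 'b pair_pre_digraph set \<Rightarrow> bool" where
  "induced_arrows r G F \<longleftrightarrow>
     (\<forall>c \<in> pverts G \<rightarrow> {1..r}. \<exists>H\<in>F. \<exists>C. is_induced_copy C H G \<and>
        (\<exists>k\<in>{1..r}. \<forall>v\<in>pverts C. c v = k))"

lemma cart_power_1: "cart_power G 1 = relabel (\<lambda>x. [x]) G"
proof -
  have "parcs (cart_prod (cart_power G 0) G) = (\<lambda>(x, y). (([], x), ([], y))) ` parcs G"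
    by (auto simp: cart_prod_def)
  moreover have "pverts (cart_prod (cart_power G 0) G) = Pair [] ` pverts G"
    by (auto simp: cart_prod_def)
  ultimately show ?thesis
    by (auto simp: relabel_def image_image map_prod_def split_beta simp del: cart_power.simps(1))
qed

lemma pverts_cart_power: "pverts (cart_power G N) = {xs. set xs \<subseteq> pverts G \<and> length xs = N}"
proof (induction N)
  case (Suc N)
  show ?case
  proof (intro set_eqI iffI)
    fix xs assume "xs \<in> pverts (cart_power G (Suc N))"
    then show "xs \<in> {xs. set xs \<subseteq> pverts G \<and> length xs = Suc N}"
      using Suc by (auto simp: relabel_def cart_prod_def)
  next
    fix xs assume "xs \<in> {xs. set xs \<subseteq> pverts G \<and> length xs = Suc N}"
    then show "xs \<in> pverts (cart_power G (Suc N))"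
      using Suc by (cases xs rule: rev_cases) (auto simp: relabel_def cart_prod_def)
  qed
qed auto

lemma pair_graph_cart_prod:
  assumes "pair_graph G" "pair_graph H"
  shows "pair_graph (cart_prod G H)"
proof -
  interpret G: pair_graph G by fact
  interpret H: pair_graph H by fact
  have sG: "(y, x) \<in> parcs G" if "(x, y) \<in> parcs G" for x y
    using that G.pair_sym_arcs by (auto simp: symmetric_def sym_def)
  have sH: "(y, x) \<in> parcs H" if "(x, y) \<in> parcs H" for x y
    using that H.pair_sym_arcs by (auto simp: symmetric_def sym_def)
  have sub: "parcs (cart_prod G H) \<subseteq> pverts (cart_prod G H) \<times> pverts (cart_prod G H)"
    by (auto simp: cart_prod_def dest: G.wellformed' H.wellformed')
  have fin: "finite (pverts (cart_prod G H))"
    by (simp add: cart_prod_def)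
  show ?thesis
  proof
    show "finite (parcs (cart_prod G H))"
      by (rule finite_subset[OF sub]) (simp add: fin)
    show "symmetric (cart_prod G H)"
      by (auto simp: symmetric_def sym_def cart_prod_def intro: sG sH)
    show "fst e \<noteq> snd e" if "e \<in> parcs (cart_prod G H)" for e
      using that G.pair_no_loops H.pair_no_loops by (fastforce simp: cart_prod_def)
  qed (use sub fin in auto)
qed

lemma pair_graph_relabel:
  assumes "pair_graph G" "inj_on f (pverts G)"
  shows "pair_graph (relabel f G)"
proof -
  interpret G: pair_graph G by fact
  have s: "(y, x) \<in> parcs G" if "(x, y) \<in> parcs G" for x y
    using that G.pair_sym_arcs by (auto simp: symmetric_def sym_def)
  show ?thesis
  proof
    show "symmetric (relabel f G)"
    proof -
      have "(b, a) \<in> parcs (relabel f G)" if ab: "(a, b) \<in> parcs (relabel f G)" for a b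
      proof -
        obtain x y where "(x, y) \<in> parcs G" "a = f x" "b = f y"
          using ab by (auto simp: relabel_def)
        then show ?thesis
          using map_prod_imageI[OF s] by (simp add: relabel_def)
      qed
      then show ?thesis
        by (auto simp: symmetric_def sym_def)
    qed
    show "fst e \<noteq> snd e" if "e \<in> parcs (relabel f G)" for e
    proof -
      obtain x y where xy: "(x, y) \<in> parcs G" "e = (f x, f y)"
        using \<open>e \<in> parcs (relabel f G)\<close> by (auto simp: relabel_def)
      then have "x \<noteq> y" "x \<in> pverts G" "y \<in> pverts G"
        using G.pair_no_loops[OF xy(1)] G.wellformed' by auto
      then show ?thesis
        using xy(2) assms(2) by (auto dest: inj_onD)
    qed
  qed (auto simp: relabel_def dest: G.wellformed')
qed

lemma pair_graph_cart_power:
  assumes "pair_graph G"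
  shows "pair_graph (cart_power G N)"
proof (induction N)
  case 0
  show ?case
    by unfold_locales (auto simp: symmetric_def sym_def)
next
  case (Suc N)
  show ?case
    unfolding cart_power.simps
    by (intro pair_graph_relabel pair_graph_cart_prod Suc assms) (auto simp: inj_on_def)
qed

text \<open>A one-vertex graph has a single slice for every \<open>N \<ge> 1\<close>.\<close>

lemma card_slices:
  assumes "pair_graph G" "card (pverts G) \<ge> 2"
  shows "card (slices G N) = N * card (pverts G) ^ (N - 1)"
proof -
  interpret G: pair_graph G by fact
  let ?V = "pverts G"
  let ?L = "\<lambda>n. {xs. set xs \<subseteq> ?V \<and> length xs = n}"
  let ?I = "SIGMA j:{..<N}. ?L j \<times> ?L (N - 1 - j)"
  let ?S = "\<lambda>(j :: nat, us, vs). with_proj (cart_power G N) \<restriction> ((\<lambda>x. us @ x # vs) ` ?V)"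
  obtain a b where ab: "a \<in> ?V" "b \<in> ?V" "a \<noteq> b"
    using assms(2) by (metis G.finite_verts card_2_iff' card_le_Suc0_iff_eq not_less_eq_eq numeral_2_eq_2)
  have "slices G N = ?S ` ?I"
  proof (intro set_eqI iffI)
    fix S assume "S \<in> slices G N"
    then obtain us vs where *: "S = with_proj (cart_power G N) \<restriction> ((\<lambda>x. us @ x # vs) ` ?V)"
      "set us \<subseteq> ?V" "set vs \<subseteq> ?V" "length us + length vs + 1 = N"
      unfolding slices_def by blast
    then have "(length us, us, vs) \<in> ?I" by auto
    then show "S \<in> ?S ` ?I"
      by (rule rev_image_eqI) (simp add: *(1))
  next
    fix S assume "S \<in> ?S ` ?I"
    then show "S \<in> slices G N" by (fastforce simp: slices_def)
  qed
  moreover have "inj_on ?S ?I"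
  proof (rule inj_onI)
    fix p q assume p: "p \<in> ?I" and q: "q \<in> ?I" and eq: "?S p = ?S q"
    obtain j us vs where [simp]: "p = (j, us, vs)" by (cases p)
    obtain k us' vs' where [simp]: "q = (k, us', vs')" by (cases q)
    have len: "length us = j" "length us' = k" using p q by auto
    have img: "(\<lambda>x. us @ x # vs) ` ?V = (\<lambda>x. us' @ x # vs') ` ?V"
      using arg_cong[OF eq, of verts] by (simp add: induce_subgraph_def)
    obtain a' where a': "us @ a # vs = us' @ a' # vs'" using img ab(1) by (metis (no_types, lifting) image_iff)
    obtain b' where b': "us @ b # vs = us' @ b' # vs'" using img ab(2) by (metis (no_types, lifting) image_iff)
    have "j = k"
    proof (rule ccontr)
      assume "j \<noteq> k"
      then have "(us' @ a' # vs') ! j = (us' @ b' # vs') ! j"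
        using len by (auto simp: nth_append nth_Cons split: nat.split)
      then have "(us @ a # vs) ! j = (us @ b # vs) ! j" by (simp only: a' b')
      then show False using len ab by (simp add: nth_append)
    qed
    then show "p = q" using a' len by simp
  qed
  ultimately have "card (slices G N) = card ?I" by (simp add: card_image)
  also have "\<dots> = (\<Sum>j<N. card ?V ^ j * card ?V ^ (N - 1 - j))"
    by (simp add: card_SigmaI card_cartesian_product card_lists_length_eq finite_lists_length_eq)
  also have "\<dots> = (\<Sum>j<N. card ?V ^ (N - 1))"
    by (intro sum.cong) (auto simp flip: power_add)
  finally show ?thesis by simp
qed

end

theory Submission
  imports Defs
begin

text \<open>
  Given an \<open>r\<close>-colouring of the \<open>N\<close>-th power of \<open>G\<close>, every \<open>G\<close>-slice contains a monochromatic copy of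
  some \<open>G\<^sub>i\<close>; record its type, that is \<open>i\<close>, the copy as a subgraph of \<open>G\<close>, and the colour. The number \<open>M\<close> of
  types does not depend on \<open>N\<close>. Let \<open>n\<close> be so large that the slice density hypothesis applies to the
  \<open>n\<close>-th power of each \<open>G\<^sub>i\<close> with \<open>\<epsilon> = 1 / (2 M)\<close>. For a type \<open>t\<close> with copy given by \<open>\<phi>\<close>, take a uniformly
  random word \<open>x\<close> of length \<open>N\<close> and a random position in each of \<open>n\<close> long blocks; overwriting \<open>x\<close> at these
  positions by words \<open>\<phi> u\<close> embeds the \<open>n\<close>-th power of \<open>G\<^sub>i\<close> into that of \<open>G\<close>.

  By the second moment method a uniform random word hardly changes in distribution when a prescribed
  letter is written at a random position of a long block. So a random \<open>G\<^sub>i\<close>-slice of the embedded power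
  has type \<open>t\<close> with almost the same probability as a random \<open>G\<close>-slice, and for some \<open>t\<close> the latter is at
  least \<open>1 / M\<close>. Some embedding therefore has at least an \<open>\<epsilon>\<close>-fraction of its slices of type \<open>t\<close>, and these
  lie in one colour class, which hence contains a copy of \<open>H\<^sub>i\<close>.
\<close>

section \<open>Planting letters in random words\<close>

definition words :: "'a set \<Rightarrow> nat \<Rightarrow> 'a list set" where
  "words S n = {xs. set xs \<subseteq> S \<and> length xs = n}"

lemma finite_words: "finite S \<Longrightarrow> finite (words S n)"
  by (simp add: words_def finite_lists_length_eq)

lemma card_words: "finite S \<Longrightarrow> card (words S n) = card S ^ n"
  by (simp add: words_def card_lists_length_eq)

lemma update_in_words: "xs \<in> words S n \<Longrightarrow> a \<in> S \<Longrightarrow> xs[j := a] \<in> words S n"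
  using set_update_subset_insert by (fastforce simp: words_def)

lemma nth_in_words: "xs \<in> words S n \<Longrightarrow> j < n \<Longrightarrow> xs ! j \<in> S"
  by (auto simp: words_def)

text \<open>Swapping \<open>b\<close> with the letter at position \<open>j\<close> is an involution
  on pairs of a word and a letter. In probabilistic terms, drawing one coordinate afresh preserves
  the uniform distribution.\<close>

lemma sum_words_resample:
  fixes g :: "'a list \<Rightarrow> real"
  assumes "finite S" "j < n"
  shows "(\<Sum>x\<in>words S n. \<Sum>b\<in>S. g (x[j := b])) = real (card S) * (\<Sum>x\<in>words S n. g x)"
proof -
  have "(\<Sum>x\<in>words S n. \<Sum>b\<in>S. g (x[j := b])) = (\<Sum>(x, b)\<in>words S n \<times> S. g (x[j := b]))"
    by (rule sum.cartesian_product)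
  also have "\<dots> = (\<Sum>(x, b)\<in>words S n \<times> S. g x)"
    by (rule sum.reindex_bij_witness[where i = "\<lambda>(x, b). (x[j := b], x ! j)" and j = "\<lambda>(x, b). (x[j := b], x ! j)"])
      (use assms in \<open>auto simp: update_in_words nth_in_words words_def dest: set_update_subset_insert[THEN subsetD]\<close>)
  also have "\<dots> = (\<Sum>x\<in>words S n. \<Sum>b\<in>S. g x)"
    by (rule sum.cartesian_product[symmetric])
  finally show ?thesis
    by (simp add: sum_distrib_left)
qed

text \<open>Writing \<open>a\<close> at position \<open>j\<close> turns the uniform distribution
  into the one conditioned on \<open>x ! j = a\<close>, whose density is
  \<open>card S * of_bool (x ! j = a)\<close>. This is resampling applied to the summand with that
  indicator, where only \<open>b = a\<close> survives.\<close>

lemma sum_words_update: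
  fixes f :: "'a list \<Rightarrow> real"
  assumes "finite S" "j < n" "a \<in> S"
  shows "(\<Sum>x\<in>words S n. f (x[j := a])) = real (card S) * (\<Sum>x\<in>words S n. of_bool (x ! j = a) * f x)"
proof -
  have "(\<Sum>b\<in>S. of_bool (x[j := b] ! j = a) * f (x[j := b])) = f (x[j := a])"
    if "x \<in> words S n" for x
  proof -
    have "(\<Sum>b\<in>S. of_bool (x[j := b] ! j = a) * f (x[j := b])) = (\<Sum>b\<in>S. if b = a then f (x[j := a]) else 0)"
      using that assms by (intro sum.cong) (auto simp: words_def)
    then show ?thesis
      using assms by simp
  qed
  then show ?thesis
    using sum_words_resample[OF assms(1,2), of "\<lambda>x. of_bool (x ! j = a) * f x"] by simp
qed

text \<open>The first factor is the normalised indicator of \<open>a\<close> at \<open>j\<close>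
  minus its mean, and it is independent of any \<open>h\<close> that ignores position
  \<open>j\<close>. Taking \<open>h = 1\<close> gives mean zero; taking for \<open>h\<close> the
  deviation at another position shows that the two are uncorrelated.\<close>

lemma sum_words_letter_deviation:
  fixes h :: "'a list \<Rightarrow> real"
  assumes S: "finite S" "a \<in> S" and j: "j < n" and h: "\<And>x b. x \<in> words S n \<Longrightarrow> h (x[j := b]) = h x"
  shows "(\<Sum>x\<in>words S n. (real (card S) * of_bool (x ! j = a) - 1) * h x) = 0"
proof -
  have "(\<Sum>x\<in>words S n. h (x[j := a])) = (\<Sum>x\<in>words S n. h x)"
    by (simp add: h)
  then show ?thesis
    using sum_words_update[OF S(1) j S(2), of h]
    by (simp add: left_diff_distrib sum_subtractf sum_distrib_left mult.assoc)
qed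

text \<open>Second moment of the total deviation over \<open>J\<close>: the mixed terms vanish, so
  only the diagonal contributes.\<close>

lemma sum_words_letter_variance:
  assumes S: "finite S" "a \<in> S" and J: "J \<subseteq> {..<n}"
  shows "(\<Sum>x\<in>words S n. (\<Sum>j\<in>J. real (card S) * of_bool (x ! j = a) - 1)\<^sup>2) =
    real (card S) ^ n * real (card J) * (real (card S) - 1)"
proof -
  let ?q = "real (card S)"
  let ?d = "\<lambda>x j. ?q * of_bool (x ! j = a) - 1"
  have finJ: "finite J"
    using J finite_subset by blast
  have cov: "(\<Sum>x\<in>words S n. ?d x j * ?d x k) = (if j = k then ?q ^ n * (?q - 1) else 0)"
    if "j \<in> J" "k \<in> J" for j k
  proof (cases "j = k")
    case True
    have jn: "j < n" using that J by auto
    \<comment> \<open>The square is affine in the deviation because the indicator is idempotent; the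
      linear part then sums to zero.\<close>
    have sq: "?d x j * ?d x j = (?q - 2) * ?d x j + (?q - 1)" for x
      by (auto simp: algebra_simps)
    have "(\<Sum>x\<in>words S n. ?d x j) = 0"
      using sum_words_letter_deviation[OF S jn, of "\<lambda>_. 1"] by simp
    then have "(\<Sum>x\<in>words S n. ?d x j * ?d x j) = ?q ^ n * (?q - 1)"
      unfolding sq sum.distrib by (simp add: card_words S flip: sum_distrib_left)
    then show ?thesis using True by simp
  next
    case False
    then show ?thesis
      using sum_words_letter_deviation[OF S, of j n "\<lambda>x. ?d x k"] that J by auto
  qed
  have "(\<Sum>x\<in>words S n. (\<Sum>j\<in>J. ?d x j)\<^sup>2) = (\<Sum>x\<in>words S n. \<Sum>j\<in>J. \<Sum>k\<in>J. ?d x j * ?d x k)"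
    by (simp add: power2_eq_square sum_product)
  also have "\<dots> = (\<Sum>j\<in>J. \<Sum>x\<in>words S n. \<Sum>k\<in>J. ?d x j * ?d x k)"
    by (rule sum.swap)
  also have "\<dots> = (\<Sum>j\<in>J. \<Sum>k\<in>J. \<Sum>x\<in>words S n. ?d x j * ?d x k)"
    by (intro sum.cong refl sum.swap)
  also have "\<dots> = (\<Sum>j\<in>J. \<Sum>k\<in>J. if j = k then ?q ^ n * (?q - 1) else 0)"
    by (intro sum.cong refl cov)
  also have "\<dots> = real (card J) * (?q ^ n * (?q - 1))"
    using finJ by simp
  finally show ?thesis by simp
qed

text \<open>Writing \<open>a\<close> at a uniformly random position of \<open>J\<close> gives a
  distribution with density \<open>1 + D / card J\<close> relative to the uniform one, where
  \<open>D\<close> is the total deviation over \<open>J\<close>. The variance of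
  \<open>D / card J\<close> is \<open>(card S - 1) / card J\<close>, which is at most
  \<open>\<eta>\<^sup>2\<close>, so the mean of a function bounded by 1 drops by at most
  \<open>\<eta>\<close>.\<close>

lemma sum_words_random_update_ge:
  fixes f :: "'a list \<Rightarrow> real"
  assumes S: "finite S" "a \<in> S" and J: "J \<subseteq> {..<n}" "J \<noteq> {}"
    and f: "\<And>x. x \<in> words S n \<Longrightarrow> \<bar>f x\<bar> \<le> 1"
    and \<eta>: "\<eta> > 0" "real (card S) \<le> \<eta>\<^sup>2 * real (card J)"
  shows "real (card J) * ((\<Sum>x\<in>words S n. f x) - \<eta> * real (card S) ^ n)
    \<le> (\<Sum>j\<in>J. \<Sum>x\<in>words S n. f (x[j := a]))"
proof -
  let ?q = "real (card S)" and ?B = "real (card J)"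
  let ?D = "\<lambda>x. \<Sum>j\<in>J. ?q * of_bool (x ! j = a) - 1"
  have finJ: "finite J"
    using J finite_subset by blast
  then have B: "?B > 0"
    using J by (simp add: card_gt_0_iff)
  have "(\<Sum>j\<in>J. \<Sum>x\<in>words S n. f (x[j := a])) =
      (\<Sum>j\<in>J. \<Sum>x\<in>words S n. ?q * of_bool (x ! j = a) * f x)"
  proof (rule sum.cong[OF refl])
    fix j assume "j \<in> J"
    then have "j < n" using J by auto
    then show "(\<Sum>x\<in>words S n. f (x[j := a])) = (\<Sum>x\<in>words S n. ?q * of_bool (x ! j = a) * f x)"
      by (simp add: sum_words_update S sum_distrib_left mult.assoc)
  qed
  also have "\<dots> = (\<Sum>x\<in>words S n. \<Sum>j\<in>J. ?q * of_bool (x ! j = a) * f x)"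
    by (rule sum.swap)
  also have "\<dots> = (\<Sum>x\<in>words S n. ?D x * f x + ?B * f x)"
    by (intro sum.cong refl) (simp add: sum_subtractf left_diff_distrib flip: sum_distrib_right)
  finally have 1: "(\<Sum>j\<in>J. \<Sum>x\<in>words S n. f (x[j := a])) =
      (\<Sum>x\<in>words S n. ?D x * f x) + ?B * (\<Sum>x\<in>words S n. f x)"
    by (simp add: sum.distrib sum_distrib_left)
  \<comment> \<open>The inequality of arithmetic and geometric means replaces Cauchy-Schwarz: the
    bound is linear in the square of \<open>?D x\<close>, so it can be summed with the variance
    formula.\<close>
  have "- (\<eta> * ?B / 2 + (?D x)\<^sup>2 / (2 * \<eta> * ?B)) \<le> ?D x * f x" if "x \<in> words S n" for x
  proof -
    have "\<bar>?D x * f x\<bar> \<le> \<bar>?D x\<bar> * 1"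
      unfolding abs_mult by (intro mult_left_mono f that) simp
    moreover have "\<bar>?D x\<bar> \<le> \<eta> * ?B / 2 + (?D x)\<^sup>2 / (2 * \<eta> * ?B)"
    proof -
      have "0 \<le> (\<eta> * ?B - \<bar>?D x\<bar>)\<^sup>2" by simp
      then have "2 * \<eta> * ?B * \<bar>?D x\<bar> \<le> (\<eta> * ?B)\<^sup>2 + (?D x)\<^sup>2"
        by (simp add: power2_diff)
      then show ?thesis
        using \<eta> B by (simp add: field_simps power2_eq_square)
    qed
    ultimately show ?thesis by linarith
  qed
  then have "(\<Sum>x\<in>words S n. - (\<eta> * ?B / 2 + (?D x)\<^sup>2 / (2 * \<eta> * ?B))) \<le> (\<Sum>x\<in>words S n. ?D x * f x)"
    by (rule sum_mono)
  moreover have "(\<Sum>x\<in>words S n. - (\<eta> * ?B / 2 + (?D x)\<^sup>2 / (2 * \<eta> * ?B))) =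
      - (?q ^ n * (\<eta> * ?B / 2) + ?q ^ n * ?B * (?q - 1) / (2 * \<eta> * ?B))"
    by (simp only: sum_negf sum.distrib sum_words_letter_variance[OF S J(1)] flip: sum_divide_distrib)
      (simp add: card_words S)
  moreover have "?q ^ n * (\<eta> * ?B / 2) + ?q ^ n * ?B * (?q - 1) / (2 * \<eta> * ?B) \<le> ?q ^ n * (\<eta> * ?B)"
  proof -
    have "(?q - 1) / (2 * \<eta>) \<le> \<eta> * ?B / 2"
      using \<eta> by (simp add: field_simps power2_eq_square)
    then have "\<eta> * ?B / 2 + (?q - 1) / (2 * \<eta>) \<le> \<eta> * ?B"
      by linarith
    then have "?q ^ n * (\<eta> * ?B / 2 + (?q - 1) / (2 * \<eta>)) \<le> ?q ^ n * (\<eta> * ?B)"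
      by (rule mult_left_mono) simp
    then show ?thesis
      using B by (simp add: distrib_left)
  qed
  ultimately show ?thesis
    using 1 by (simp add: algebra_simps)
qed

text \<open>
  The positions \<open>0, \<dots>, n B - 1\<close> are cut into \<open>n\<close> blocks of length \<open>B\<close>, and \<open>p ! l\<close> is the
  offset in block \<open>l\<close> at which the letter \<open>v ! l\<close> is written.
\<close>

primrec plant :: "nat \<Rightarrow> nat list \<Rightarrow> 'a list \<Rightarrow> nat \<Rightarrow> 'a list \<Rightarrow> 'a list" where
  "plant B p v 0 x = x"
| "plant B p v (Suc s) x = plant B p v s (x[s * B + p ! s := v ! s])"

section \<open>Positions and letters of a planted word\<close>

lemma length_plant [simp]: "length (plant B p v s x) = length x"
  by (induction s arbitrary: x) auto

text \<open>The first \<open>s\<close> writes read only the offsets with index below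
  \<open>s\<close>, so a later offset may be drawn afresh without affecting them.\<close>

lemma plant_update_offset:
  "s \<le> l \<Longrightarrow> plant B (p[l := b]) v s x = plant B p v s x"
  by (induction s arbitrary: x) auto

lemma block_offset_less:
  fixes l s B k :: nat
  assumes "l < s" "k < B"
  shows "l * B + k < s * B"
proof -
  have "l * B + k < Suc l * B" using assms by simp
  also have "\<dots> \<le> s * B" using assms by (intro mult_right_mono) auto
  finally show ?thesis .
qed

lemma block_offset_eq_iff:
  fixes l s B k k' :: nat
  assumes "k < B" "k' < B"
  shows "l * B + k = s * B + k' \<longleftrightarrow> l = s \<and> k = k'"
  using assms block_offset_less[of l s k B] block_offset_less[of s l k' B]
  by (cases l s rule: linorder_cases) auto

lemma plant_nth_other:
  assumes "\<And>l. l < s \<Longrightarrow> j \<noteq> l * B + p ! l"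
  shows "plant B p v s x ! j = x ! j"
  using assms
proof (induction s arbitrary: x)
  case (Suc s)
  then have "s * B + p ! s \<noteq> j" by blast
  then show ?case using Suc by simp
qed simp

text \<open>The planted positions lie in different blocks, so no write destroys another.\<close>

lemma plant_nth_planted:
  assumes "\<And>l. l < s \<Longrightarrow> p ! l < B" "l < s" "s * B \<le> length x"
  shows "plant B p v s x ! (l * B + p ! l) = v ! l"
  using assms
proof (induction s arbitrary: x)
  case (Suc s)
  show ?case
  proof (cases "l = s")
    case True
    have "s * B + p ! s < length x"
      using Suc.prems(1)[of s] Suc.prems(3) by simp
    moreover have "s * B + p ! s \<noteq> k * B + p ! k" if "k < s" for k
      using that Suc.prems(1)[of k] Suc.prems(1)[of s] by (simp add: block_offset_eq_iff)
    ultimately show ?thesis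
      using True by (simp add: plant_nth_other)
  qed (use Suc in auto)
qed simp

lemma plant_in_words:
  assumes "x \<in> words V N" "v \<in> words V n" "s \<le> n"
  shows "plant B p v s x \<in> words V N"
  using assms
proof (induction s arbitrary: x)
  case (Suc s)
  then have "v ! s \<in> V" using nth_in_words[of v V n s] by simp
  then show ?case using Suc by (simp add: update_in_words)
qed simp

lemma plant_list_update:
  assumes "\<And>i. i < s \<Longrightarrow> p ! i < B" "s * B \<le> j"
  shows "plant B p v s (x[j := a]) = (plant B p v s x)[j := a]"
  using assms
proof (induction s arbitrary: x)
  case (Suc s)
  have "s * B + p ! s \<noteq> j"
    using Suc.prems(1)[of s] Suc.prems(2) by simp
  then have "x[j := a, s * B + p ! s := v ! s] = x[s * B + p ! s := v ! s, j := a]"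
    by (simp add: list_update_swap)
  then show ?case
    using Suc by simp
qed simp

text \<open>Changing one letter of the planted word changes one position of the result. Hence
  planting carries a slice in direction \<open>l\<close> into a slice in direction
  \<open>l * B + p ! l\<close>.\<close>

lemma plant_update_letter:
  assumes "p \<in> words {..<B} n" "n * B \<le> length x" "l < n" "length v = n"
  shows "plant B p (v[l := a]) n x = (plant B p v n x)[l * B + p ! l := a]"
proof (rule nth_equalityI)
  fix j assume "j < length (plant B p (v[l := a]) n x)"
  then have j: "j < length x" by simp
  have p: "p ! k < B" if "k < n" for k
    using nth_in_words[OF assms(1) that] by simp
  show "plant B p (v[l := a]) n x ! j = (plant B p v n x)[l * B + p ! l := a] ! j"
  proof (cases "\<exists>k<n. j = k * B + p ! k")
    case True
    then obtain k where "k < n" "j = k * B + p ! k" by blast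
    then show ?thesis
      using assms p j by (auto simp: plant_nth_planted nth_list_update block_offset_eq_iff)
  next
    case False
    then have "l * B + p ! l \<noteq> j"
      using assms(3) by blast
    then show ?thesis
      using False by (simp add: plant_nth_other)
  qed
qed simp

text \<open>Induction on the number of letters written. A letter in a block other than
  \<open>l\<close> costs at most \<open>\<eta>\<close> in probability, as its offset is random and
  independent of the observed position. The letter of block \<open>l\<close> costs nothing: it is
  written at the observed position, which \<open>\<tau>\<close> ignores.\<close>

lemma sum_plant_ge:
  fixes \<tau> :: "nat \<Rightarrow> 'a list \<Rightarrow> 't"
  assumes V: "finite V" and v: "v \<in> words V n" and l: "l < n" and N: "n * B \<le> N" and B: "B > 0"
    and \<tau>: "\<And>j x b. \<tau> j (x[j := b]) = \<tau> j x"
    and \<eta>: "\<eta> > 0" "real (card V) \<le> \<eta>\<^sup>2 * real B"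
    and s: "s \<le> n"
  shows "(\<Sum>p\<in>words {..<B} n. \<Sum>x\<in>words V N. of_bool (\<tau> (l * B + p ! l) x = t))
      - real s * \<eta> * real B ^ n * real (card V) ^ N
    \<le> (\<Sum>p\<in>words {..<B} n. \<Sum>x\<in>words V N. of_bool (\<tau> (l * B + p ! l) (plant B p v s x) = t))"
  using s
proof (induction s)
  case (Suc s)
  let ?P = "words {..<B} n" and ?X = "words V N" and ?q = "real (card V)"
  define F where "F s p x = (of_bool (\<tau> (l * B + p ! l) (plant B p v s x) = t) :: real)" for s p x
  have "(\<Sum>p\<in>?P. \<Sum>x\<in>?X. F s p x) - \<eta> * real B ^ n * ?q ^ N \<le> (\<Sum>p\<in>?P. \<Sum>x\<in>?X. F (Suc s) p x)"
  proof (cases "s = l")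
    case True
    have "F (Suc s) p x = F s p x" if "p \<in> ?P" for p x
      using nth_in_words[OF that] l by (simp add: F_def True \<tau> plant_list_update)
    then show ?thesis using \<eta> by simp
  next
    case False
    let ?J = "(\<lambda>b. s * B + b) ` {..<B}"
    have sn: "s < n" using Suc.prems by simp
    have J: "?J \<subseteq> {..<N}" "?J \<noteq> {}" "card ?J = B"
      using B N block_offset_less[OF sn] by (fastforce simp: card_image inj_on_def)+
    have vs: "v ! s \<in> V" using v sn by (rule nth_in_words)
    have F: "F (Suc s) (p[s := b]) x = F s p (x[s * B + b := v ! s])" if "p \<in> ?P" for p b x
      using that sn False by (simp add: F_def plant_update_offset words_def)
    have "real B * ((\<Sum>p\<in>?P. \<Sum>x\<in>?X. F s p x) - \<eta> * real B ^ n * ?q ^ N)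
        = (\<Sum>p\<in>?P. real B * ((\<Sum>x\<in>?X. F s p x) - \<eta> * ?q ^ N))"
      by (simp add: sum_subtractf card_words algebra_simps flip: sum_distrib_left)
    also have "\<dots> \<le> (\<Sum>p\<in>?P. \<Sum>j\<in>?J. \<Sum>x\<in>?X. F s p (x[j := v ! s]))"
    proof (rule sum_mono)
      fix p
      show "real B * ((\<Sum>x\<in>?X. F s p x) - \<eta> * ?q ^ N) \<le> (\<Sum>j\<in>?J. \<Sum>x\<in>?X. F s p (x[j := v ! s]))"
        using sum_words_random_update_ge[OF V vs J(1,2), of "F s p" \<eta>] \<eta> J(3) by (simp add: F_def)
    qed
    also have "\<dots> = (\<Sum>p\<in>?P. \<Sum>b<B. \<Sum>x\<in>?X. F (Suc s) (p[s := b]) x)"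
      by (rule sum.cong[OF refl]) (simp add: F sum.reindex inj_on_def)
    \<comment> \<open>Here resampling is applied to the word of offsets: averaging over both
      \<open>p\<close> and a fresh offset \<open>b\<close> for block \<open>s\<close> is averaging
      over \<open>p\<close> alone.\<close>
    also have "\<dots> = real B * (\<Sum>p\<in>?P. \<Sum>x\<in>?X. F (Suc s) p x)"
      using sum_words_resample[of "{..<B}" s n "\<lambda>p. \<Sum>x\<in>?X. F (Suc s) p x"] sn by simp
    finally show ?thesis using B by simp
  qed
  moreover have "(\<Sum>p\<in>?P. \<Sum>x\<in>?X. of_bool (\<tau> (l * B + p ! l) x = t)) - real s * \<eta> * real B ^ n * ?q ^ N
      \<le> (\<Sum>p\<in>?P. \<Sum>x\<in>?X. F s p x)"
    using Suc by (simp add: F_def)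
  ultimately show ?case
    by (simp add: F_def algebra_simps)
qed simp

section \<open>A planting with many slices of one type\<close>

lemma ex_ge_average:
  fixes f :: "'a \<Rightarrow> real"
  assumes "finite A" "A \<noteq> {}" "real (card A) * c \<le> sum f A"
  shows "\<exists>a\<in>A. c \<le> f a"
proof (rule ccontr)
  assume "\<not> ?thesis"
  then have "sum f A < real (card A) * c"
    using assms by (intro sum_bounded_above_strict) (auto simp: card_gt_0_iff)
  then show False using assms by simp
qed

text \<open>Three averagings. Before planting, some type \<open>t\<close> has probability at least
  \<open>1 / card T\<close> over a random direction \<open>l\<close>, \<open>p\<close> and
  \<open>x\<close>. For every word over \<open>U t\<close>, planting its image keeps this up to a
  loss of \<open>n * \<eta>\<close>, at most half. Averaging over \<open>p\<close> and
  \<open>x\<close> then fixes one planting that is good for enough of the pairs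
  \<open>(l, v)\<close>.\<close>

lemma dense_planting:
  fixes \<tau> :: "nat \<Rightarrow> 'a list \<Rightarrow> 't" and U :: "'t \<Rightarrow> 'b set"
  assumes T: "finite T" "T \<noteq> {}" and V: "finite V" "V \<noteq> {}"
    and U: "\<And>t. t \<in> T \<Longrightarrow> finite (U t)" "\<And>t. t \<in> T \<Longrightarrow> \<phi> t ` U t \<subseteq> V"
    and N: "n * B \<le> N" and B: "B > 0"
    and \<tau>: "\<And>j x b. \<tau> j (x[j := b]) = \<tau> j x"
      "\<And>j x. j < N \<Longrightarrow> x \<in> words V N \<Longrightarrow> \<tau> j x \<in> T"
    and \<eta>: "\<eta> > 0" "real (card V) \<le> \<eta>\<^sup>2 * real B" "real n * \<eta> \<le> 1 / (2 * real (card T))"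
  shows "\<exists>t\<in>T. \<exists>p\<in>words {..<B} n. \<exists>x\<in>words V N.
    1 / (2 * real (card T)) * (real n * real (card (U t)) ^ n) \<le> real (card {(l, v). l < n \<and>
      v \<in> words (U t) n \<and> \<tau> (l * B + p ! l) (plant B p (map (\<phi> t) v) n x) = t})"
proof -
  let ?P = "words {..<B} n" and ?X = "words V N"
  let ?M = "real (card T)" and ?w = "real B ^ n * real (card V) ^ N"
  have fin: "finite ?P" "finite ?X"
    using V by (auto intro: finite_words)
  have M: "?M > 0" using T by (simp add: card_gt_0_iff)
  have card: "real (card (?P \<times> ?X)) = ?w"
    using V by (simp add: card_words card_cartesian_product)
  have w: "?w > 0" using B V by (simp add: card_gt_0_iff)
  define A where "A t l = (\<Sum>p\<in>?P. \<Sum>x\<in>?X. of_bool (\<tau> (l * B + p ! l) x = t) :: real)" for t l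
  have A_sum: "(\<Sum>t\<in>T. A t l) = ?w" if "l < n" for l
  proof -
    have one: "(\<Sum>t\<in>T. of_bool (\<tau> (l * B + p ! l) x = t) :: real) = 1" if "p \<in> ?P" "x \<in> ?X" for p x
    proof -
      have "l * B + p ! l < N"
        using block_offset_less[OF \<open>l < n\<close>, of "p ! l" B] nth_in_words[OF that(1) \<open>l < n\<close>] N by simp
      then have "\<tau> (l * B + p ! l) x \<in> T" using \<tau>(2) that(2) by blast
      then show ?thesis using T by (simp add: of_bool_def)
    qed
    have "(\<Sum>t\<in>T. A t l) = (\<Sum>p\<in>?P. \<Sum>t\<in>T. \<Sum>x\<in>?X. of_bool (\<tau> (l * B + p ! l) x = t))"
      unfolding A_def by (rule sum.swap)
    also have "\<dots> = (\<Sum>p\<in>?P. \<Sum>x\<in>?X. \<Sum>t\<in>T. of_bool (\<tau> (l * B + p ! l) x = t))"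
      by (intro sum.cong refl sum.swap)
    also have "\<dots> = (\<Sum>p\<in>?P. \<Sum>x\<in>?X. 1)"
      by (intro sum.cong refl one)
    finally show ?thesis using V by (simp add: card_words)
  qed
  have "(\<Sum>t\<in>T. \<Sum>l<n. A t l) = (\<Sum>l<n. \<Sum>t\<in>T. A t l)"
    by (rule sum.swap)
  also have "\<dots> = real n * ?w"
    by (simp add: A_sum)
  finally have "\<exists>t\<in>T. real n * ?w / ?M \<le> (\<Sum>l<n. A t l)"
    using M by (intro ex_ge_average T) simp
  then obtain t where t: "t \<in> T" "real n * ?w / ?M \<le> (\<Sum>l<n. A t l)" by blast
  let ?W = "words (U t) n"
  let ?u = "real (card (U t)) ^ n"
  let ?Z = "\<lambda>p x l v. of_bool (\<tau> (l * B + p ! l) (plant B p (map (\<phi> t) v) n x) = t) :: real"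
  have finW: "finite ?W" using U t by (simp add: finite_words)
  have loss: "A t l - real n * \<eta> * ?w \<le> (\<Sum>p\<in>?P. \<Sum>x\<in>?X. ?Z p x l v)" if "l < n" "v \<in> ?W" for l v
  proof -
    have "map (\<phi> t) v \<in> words V n"
      using that U(2)[OF t(1)] by (auto simp: words_def)
    from sum_plant_ge[OF V(1) this that(1) N B \<tau>(1) \<eta>(1,2) order_refl, of t]
    show ?thesis by (simp add: A_def mult.assoc)
  qed
  \<comment> \<open>Half of the density \<open>1 / ?M\<close> of type \<open>t\<close> pays for the
    \<open>n\<close> planted letters.\<close>
  have "real n * ?w / (2 * ?M) \<le> real n * ?w / ?M - real n * (real n * \<eta> * ?w)"
  proof -
    have "(real n * ?w) * (real n * \<eta>) \<le> (real n * ?w) * (1 / (2 * ?M))"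
      using \<eta>(3) w by (intro mult_left_mono) auto
    moreover have "real n * ?w / ?M = real n * ?w / (2 * ?M) + (real n * ?w) * (1 / (2 * ?M))"
      using M by (simp add: field_simps)
    moreover have "real n * (real n * \<eta> * ?w) = (real n * ?w) * (real n * \<eta>)"
      by simp
    ultimately show ?thesis by linarith
  qed
  also have "\<dots> \<le> (\<Sum>l<n. A t l - real n * \<eta> * ?w)"
    using t(2) by (simp add: sum_subtractf)
  \<comment> \<open>Since the bound holds for each planted word, it may be summed over all of them;
    the sums are then exchanged to average over \<open>(p, x)\<close>.\<close>
  finally have "?u * (real n * ?w / (2 * ?M)) \<le> ?u * (\<Sum>l<n. A t l - real n * \<eta> * ?w)"
    by (rule mult_left_mono) simp
  also have "\<dots> = (\<Sum>l<n. \<Sum>v\<in>?W. A t l - real n * \<eta> * ?w)"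
    using U t by (simp add: card_words sum_distrib_left)
  also have "\<dots> \<le> (\<Sum>l<n. \<Sum>v\<in>?W. \<Sum>p\<in>?P. \<Sum>x\<in>?X. ?Z p x l v)"
    by (intro sum_mono loss) auto
  also have "\<dots> = (\<Sum>l<n. \<Sum>v\<in>?W. \<Sum>(p, x)\<in>?P \<times> ?X. ?Z p x l v)"
    by (intro sum.cong refl sum.cartesian_product)
  also have "\<dots> = (\<Sum>(l, v)\<in>{..<n} \<times> ?W. \<Sum>(p, x)\<in>?P \<times> ?X. ?Z p x l v)"
    by (rule sum.cartesian_product)
  also have "\<dots> = (\<Sum>(p, x)\<in>?P \<times> ?X. \<Sum>(l, v)\<in>{..<n} \<times> ?W. ?Z p x l v)"
    unfolding case_prod_unfold by (rule sum.swap)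
  finally have "real (card (?P \<times> ?X)) * (1 / (2 * ?M) * (real n * ?u)) \<le> \<dots>"
    unfolding card by (simp add: mult_ac)
  then have "\<exists>px\<in>?P \<times> ?X. 1 / (2 * ?M) * (real n * ?u) \<le>
      (case px of (p, x) \<Rightarrow> \<Sum>(l, v)\<in>{..<n} \<times> ?W. ?Z p x l v)"
  proof (rule ex_ge_average[rotated 2])
    show "?P \<times> ?X \<noteq> {}"
      using w card by (metis card.empty of_nat_0 less_irrefl)
  qed (use fin in simp)
  then obtain p x where px: "p \<in> ?P" "x \<in> ?X"
      "1 / (2 * ?M) * (real n * ?u) \<le> (\<Sum>(l, v)\<in>{..<n} \<times> ?W. ?Z p x l v)"
    by (elim bexE SigmaE) simp
  have "(\<Sum>(l, v)\<in>{..<n} \<times> ?W. ?Z p x l v) =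
      real (card {lv \<in> {..<n} \<times> ?W. case lv of (l, v) \<Rightarrow> \<tau> (l * B + p ! l) (plant B p (map (\<phi> t) v) n x) = t})"
    using finW by (simp add: case_prod_unfold sum_of_bool_eq Int_def)
  also have "{lv \<in> {..<n} \<times> ?W. case lv of (l, v) \<Rightarrow> \<tau> (l * B + p ! l) (plant B p (map (\<phi> t) v) n x) = t} =
      {(l, v). l < n \<and> v \<in> ?W \<and> \<tau> (l * B + p ! l) (plant B p (map (\<phi> t) v) n x) = t}"
    by auto
  finally have "1 / (2 * ?M) * (real n * ?u) \<le> real (card {(l, v). l < n \<and> v \<in> ?W \<and>
      \<tau> (l * B + p ! l) (plant B p (map (\<phi> t) v) n x) = t})"
    using px(3) by simp
  with t(1) px(1,2) show ?thesis by blast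
qed

section \<open>Copies in Cartesian powers\<close>

lemma subgraph_pair_iff:
  "subgraph (with_proj H) (with_proj G) \<longleftrightarrow> pverts H \<subseteq> pverts G \<and> parcs H \<subseteq> parcs G \<and>
    pair_wf_digraph G \<and> pair_wf_digraph H"
  by (auto simp: subgraph_def wf_digraph_wp_iff)

lemma induced_subgraph_pair_iff:
  "induced_subgraph (with_proj H) (with_proj G) \<longleftrightarrow> subgraph (with_proj H) (with_proj G) \<and>
    parcs H = {e \<in> parcs G. fst e \<in> pverts H \<and> snd e \<in> pverts H}"
  by (simp add: induced_subgraph_def)

lemma pverts_relabel: "pverts (relabel f G) = f ` pverts G"
  by (simp add: relabel_def)

lemma pair_wf_digraph_relabel: "pair_wf_digraph G \<Longrightarrow> pair_wf_digraph (relabel f G)"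
  by (auto simp: pair_wf_digraph_def relabel_def)

lemma relabel_relabel: "relabel f (relabel g G) = relabel (\<lambda>x. f (g x)) G"
  by (simp add: relabel_def image_image map_prod_def case_prod_unfold)

text \<open>An isomorphism also carries an arc map and new end functions. Between pair digraphs the
  ends must be \<open>fst\<close> and \<open>snd\<close>, so the vertex map determines the action on
  arcs.\<close>

lemma digraph_iso_pair_iff:
  "digraph_iso (with_proj H) (with_proj C) \<longleftrightarrow>
    pair_wf_digraph H \<and> (\<exists>f. inj_on f (pverts H) \<and> C = relabel f H)"
proof
  assume "digraph_iso (with_proj H) (with_proj C)"
  then obtain h where h: "pre_digraph.digraph_isomorphism (with_proj H) h"
    and C: "with_proj C = app_iso h (with_proj H)"
    by (auto simp: digraph_iso_def)
  have wf: "pair_wf_digraph H" and inj: "inj_on (iso_verts h) (pverts H)"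
    and ends: "\<And>a. a \<in> parcs H \<Longrightarrow> iso_verts h (fst a) = iso_tail h (iso_arcs h a) \<and>
      iso_verts h (snd a) = iso_head h (iso_arcs h a)"
    using h by (auto simp: pre_digraph.digraph_isomorphism_def wf_digraph_wp_iff)
  have "iso_tail h = fst" "iso_head h = snd"
    using arg_cong[OF C, of tail] arg_cong[OF C, of head] by simp_all
  then have "iso_arcs h a = map_prod (iso_verts h) (iso_verts h) a" if "a \<in> parcs H" for a
    using ends[OF that] by (simp add: prod_eq_iff)
  then have "parcs C = map_prod (iso_verts h) (iso_verts h) ` parcs H"
    using arg_cong[OF C, of arcs] by simp
  moreover have "pverts C = iso_verts h ` pverts H"
    using arg_cong[OF C, of verts] by simp
  ultimately have "C = relabel (iso_verts h) H"
    by (simp add: relabel_def)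
  then show "pair_wf_digraph H \<and> (\<exists>f. inj_on f (pverts H) \<and> C = relabel f H)"
    using wf inj by blast
next
  assume "pair_wf_digraph H \<and> (\<exists>f. inj_on f (pverts H) \<and> C = relabel f H)"
  then obtain f where wf: "pair_wf_digraph H" and f: "inj_on f (pverts H)" "C = relabel f H"
    by blast
  let ?h = "\<lparr>iso_verts = f, iso_arcs = map_prod f f, iso_head = snd, iso_tail = fst\<rparr>"
  have "parcs H \<subseteq> pverts H \<times> pverts H"
    using wf by (auto simp: pair_wf_digraph_def)
  then have "inj_on (map_prod f f) (parcs H)"
    using f map_prod_inj_on inj_on_subset by blast
  then have "pre_digraph.digraph_isomorphism (with_proj H) ?h"
    using wf f by (simp add: pre_digraph.digraph_isomorphism_def wf_digraph_wp_iff)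
  moreover have "with_proj C = app_iso ?h (with_proj H)"
    using f by (simp add: app_iso_def with_proj_def relabel_def)
  ultimately show "digraph_iso (with_proj H) (with_proj C)"
    unfolding digraph_iso_def by blast
qed

text \<open>
  The flag \<open>ind\<close> selects between induced subgraphs and arbitrary ones, so that both halves of the
  theorem share one proof.
\<close>

definition sub_in :: "bool \<Rightarrow> 'a pair_pre_digraph \<Rightarrow> 'a pair_pre_digraph \<Rightarrow> bool" where
  "sub_in ind C G \<longleftrightarrow> (if ind then induced_subgraph C G else subgraph C G)"

definition copy_in :: "bool \<Rightarrow> 'a pair_pre_digraph \<Rightarrow> 'b pair_pre_digraph \<Rightarrow> 'a pair_pre_digraph \<Rightarrow> bool" where
  "copy_in ind C H G \<longleftrightarrow> (if ind then is_induced_copy C H G else is_copy C H G)"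

lemma sub_in_iff:
  "sub_in ind C G \<longleftrightarrow> pverts C \<subseteq> pverts G \<and> parcs C \<subseteq> parcs G \<and> pair_wf_digraph G \<and> pair_wf_digraph C \<and>
    (ind \<longrightarrow> (\<forall>u\<in>pverts C. \<forall>v\<in>pverts C. (u, v) \<in> parcs G \<longrightarrow> (u, v) \<in> parcs C))"
proof -
  have "parcs C = {e \<in> parcs G. fst e \<in> pverts C \<and> snd e \<in> pverts C} \<longleftrightarrow>
      (\<forall>u\<in>pverts C. \<forall>v\<in>pverts C. (u, v) \<in> parcs G \<longrightarrow> (u, v) \<in> parcs C)" (is "?L \<longleftrightarrow> ?R")
    if "parcs C \<subseteq> parcs G" "pair_wf_digraph C"
  proof
    assume ?R
    have "parcs C \<subseteq> pverts C \<times> pverts C"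
      using that(2) by (auto dest: pair_wf_digraph.wellformed')
    with \<open>?R\<close> that(1) show ?L by auto
  qed auto
  then show ?thesis
    unfolding sub_in_def induced_subgraph_pair_iff subgraph_pair_iff by (cases ind) (simp; blast)+
qed

lemma copy_in_iff:
  "copy_in ind C H G \<longleftrightarrow>
    sub_in ind C G \<and> pair_wf_digraph H \<and> (\<exists>f. inj_on f (pverts H) \<and> C = relabel f H)"
  by (simp add: copy_in_def sub_in_def is_copy_def is_induced_copy_def digraph_iso_pair_iff)

text \<open>Transitivity along an embedding. In the induced case an arc of \<open>G\<close> between
  images comes from an arc of \<open>K\<close>; injectivity of \<open>f\<close> identifies its ends,
  and \<open>D\<close> is induced in \<open>K\<close>.\<close>

lemma sub_in_relabel:
  assumes D: "sub_in ind D K" and f: "inj_on f (pverts K)" and K: "sub_in ind (relabel f K) G"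
  shows "sub_in ind (relabel f D) G"
proof -
  have DK: "pverts D \<subseteq> pverts K" "parcs D \<subseteq> parcs K" "pair_wf_digraph D" "pair_wf_digraph K"
    using D by (auto simp: sub_in_iff)
  have arc: "(f u, f v) \<in> parcs (relabel f D)"
    if "ind" "u \<in> pverts D" "v \<in> pverts D" "(f u, f v) \<in> parcs G" for u v
  proof -
    have uv: "u \<in> pverts K" "v \<in> pverts K" using that DK by auto
    then have "(f u, f v) \<in> parcs (relabel f K)"
      using K that unfolding sub_in_iff pverts_relabel by blast
    then obtain u' v' where "(u', v') \<in> parcs K" "f u = f u'" "f v = f v'"
      by (auto simp: relabel_def)
    moreover from this have "u' \<in> pverts K" "v' \<in> pverts K"
      using DK(4) by (auto simp: pair_wf_digraph_def)
    ultimately have "(u, v) \<in> parcs K"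
      using inj_onD[OF f, of u u'] inj_onD[OF f, of v v'] uv by simp
    then have "(u, v) \<in> parcs D"
      using D that unfolding sub_in_iff by blast
    from map_prod_imageI[OF this, of f f] show ?thesis
      by (simp add: relabel_def)
  qed
  have "pverts (relabel f D) \<subseteq> pverts G" "parcs (relabel f D) \<subseteq> parcs G"
    using K image_mono[OF DK(1), of f] image_mono[OF DK(2), of "map_prod f f"]
    by (simp_all add: sub_in_iff relabel_def subset_trans)
  moreover have "pair_wf_digraph G" "pair_wf_digraph (relabel f D)"
    using K pair_wf_digraph_relabel[OF DK(3)] by (auto simp: sub_in_iff)
  moreover have "ind \<longrightarrow> (\<forall>u\<in>pverts (relabel f D). \<forall>v\<in>pverts (relabel f D).
      (u, v) \<in> parcs G \<longrightarrow> (u, v) \<in> parcs (relabel f D))"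
    unfolding pverts_relabel ball_simps(9) using arc by blast
  ultimately show ?thesis
    unfolding sub_in_iff by - (intro conjI; assumption)
qed

lemma copy_in_relabel:
  assumes D: "copy_in ind D H K" and f: "inj_on f (pverts K)" and K: "sub_in ind (relabel f K) G"
  shows "copy_in ind (relabel f D) H G"
proof -
  obtain g where g: "inj_on g (pverts H)" "D = relabel g H"
    using D by (auto simp: copy_in_iff)
  have "sub_in ind D K" "pair_wf_digraph H"
    using D by (simp_all add: copy_in_iff)
  then have "g ` pverts H \<subseteq> pverts K"
    by (simp add: g(2) sub_in_iff pverts_relabel)
  then have "inj_on (\<lambda>x. f (g x)) (pverts H)"
    using comp_inj_on[OF g(1) inj_on_subset[OF f]] by (simp add: o_def)
  moreover have "relabel f D = relabel (\<lambda>x. f (g x)) H"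
    by (simp add: g(2) relabel_relabel)
  moreover have "sub_in ind (relabel f D) G"
    using \<open>sub_in ind D K\<close> f K by (rule sub_in_relabel)
  ultimately show ?thesis
    unfolding copy_in_iff using \<open>pair_wf_digraph H\<close> by metis
qed

definition induced_on :: "'a pair_pre_digraph \<Rightarrow> 'a set \<Rightarrow> 'a pair_pre_digraph" where
  "induced_on G X = \<lparr>pverts = X, parcs = {e \<in> parcs G. fst e \<in> X \<and> snd e \<in> X}\<rparr>"

lemma sub_in_induced_on:
  "pair_wf_digraph G \<Longrightarrow> X \<subseteq> pverts G \<Longrightarrow> sub_in ind (induced_on G X) G"
  by (auto simp: sub_in_iff induced_on_def pair_wf_digraph_def)

lemma pair_graph_induced_on:
  assumes "pair_graph G" "X \<subseteq> pverts G"
  shows "pair_graph (induced_on G X)"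
proof -
  interpret G: pair_graph G by fact
  show ?thesis
  proof
    show "finite (pverts (induced_on G X))"
      using finite_subset[OF assms(2)] by (simp add: induced_on_def)
    show "symmetric (induced_on G X)"
      using G.pair_sym_arcs by (auto simp: symmetric_def sym_def induced_on_def)
  qed (use G.pair_no_loops in \<open>auto simp: induced_on_def\<close>)
qed

section \<open>Arcs of Cartesian powers and the embedding by planting\<close>

lemma pverts_cart_power_eq_words: "pverts (cart_power G N) = words (pverts G) N"
  by (simp add: pverts_cart_power words_def)

text \<open>This form names the direction \<open>j\<close> of an arc, as planting requires. In the
  induction an arc either moves within the old coordinates or in the appended one,
  \<open>j = N\<close>.\<close>

lemma arc_cart_power_iff:
  assumes "pair_wf_digraph G"
  shows "(x, y) \<in> parcs (cart_power G N) \<longleftrightarrow>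
    x \<in> words (pverts G) N \<and> (\<exists>j<N. \<exists>b. (x ! j, b) \<in> parcs G \<and> y = x[j := b])"
proof (induction N arbitrary: x y)
  case (Suc N)
  have wf: "a \<in> pverts G" "b \<in> pverts G" if "(a, b) \<in> parcs G" for a b
    using assms that by (auto simp: pair_wf_digraph_def)
  have step: "(x, y) \<in> parcs (cart_power G (Suc N)) \<longleftrightarrow>
    (\<exists>xs a ys b. x = xs @ [a] \<and> y = ys @ [b] \<and>
      ((xs, ys) \<in> parcs (cart_power G N) \<and> a = b \<and> a \<in> pverts G \<or>
       xs = ys \<and> xs \<in> words (pverts G) N \<and> (a, b) \<in> parcs G))"
    (is "_ \<longleftrightarrow> ?R")
  proof
    assume "(x, y) \<in> parcs (cart_power G (Suc N))"
    then obtain xs a ys b where "((xs, a), (ys, b)) \<in> parcs (cart_prod (cart_power G N) G)"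
        "x = xs @ [a]" "y = ys @ [b]"
      by (auto simp: relabel_def)
    then show ?R
      by (simp add: cart_prod_def pverts_cart_power_eq_words)
  next
    assume ?R
    then obtain xs a ys b where *: "((xs, a), (ys, b)) \<in> parcs (cart_prod (cart_power G N) G)"
        "x = xs @ [a]" "y = ys @ [b]"
      by (simp add: cart_prod_def pverts_cart_power_eq_words) blast
    show "(x, y) \<in> parcs (cart_power G (Suc N))"
      unfolding cart_power.simps relabel_def pair_pre_digraph.simps
      by (rule image_eqI[OF _ *(1)]) (simp add: *)
  qed
  show ?case
  proof
    assume "(x, y) \<in> parcs (cart_power G (Suc N))"
    then consider (old) xs a ys where "x = xs @ [a]" "y = ys @ [a]" "(xs, ys) \<in> parcs (cart_power G N)" "a \<in> pverts G"
      | (new) xs a b where "x = xs @ [a]" "y = xs @ [b]" "xs \<in> words (pverts G) N" "(a, b) \<in> parcs G"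
      unfolding step by blast
    then show "x \<in> words (pverts G) (Suc N) \<and> (\<exists>j<Suc N. \<exists>b. (x ! j, b) \<in> parcs G \<and> y = x[j := b])"
    proof cases
      case old
      then obtain j b where "xs \<in> words (pverts G) N" "j < N" "(xs ! j, b) \<in> parcs G" "ys = xs[j := b]"
        using Suc by blast
      then show ?thesis
        using old by (auto simp: words_def nth_append list_update_append intro!: exI[of _ j] exI[of _ b])
    next
      case new
      then show ?thesis
        using wf by (auto simp: words_def nth_append list_update_append intro!: exI[of _ N] exI[of _ b])
    qed
  next
    assume R: "x \<in> words (pverts G) (Suc N) \<and> (\<exists>j<Suc N. \<exists>b. (x ! j, b) \<in> parcs G \<and> y = x[j := b])"
    then obtain j b where j: "j < Suc N" "(x ! j, b) \<in> parcs G" "y = x[j := b]" by blast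
    obtain xs a where x: "x = xs @ [a]"
      using R by (cases x rule: rev_cases) (auto simp: words_def)
    have xs: "xs \<in> words (pverts G) N" "a \<in> pverts G" "length xs = N"
      using R x by (auto simp: words_def)
    show "(x, y) \<in> parcs (cart_power G (Suc N))"
    proof (cases "j = N")
      case True
      then show ?thesis
        unfolding step using j x xs by auto
    next
      case False
      then have "j < N" "(xs ! j, b) \<in> parcs G" and y: "y = xs[j := b] @ [a]"
        using j x xs by (auto simp: nth_append list_update_append)
      then have "(xs, xs[j := b]) \<in> parcs (cart_power G N)"
        using Suc xs by blast
      then show ?thesis
        unfolding step using x y xs by blast
    qed
  qed
qed simp

lemma plant_map_nth:
  assumes "p \<in> words {..<B} n" "n * B \<le> length x" "length u = n" "l < n"
  shows "plant B p (map f u) n x ! (l * B + p ! l) = f (u ! l)"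
  using assms nth_in_words[OF assms(1)] by (simp add: plant_nth_planted)

lemma inj_on_plant_map:
  assumes "p \<in> words {..<B} n" "n * B \<le> length x" "inj_on f U"
  shows "inj_on (\<lambda>u. plant B p (map f u) n x) (words U n)"
proof (rule inj_onI)
  fix u v assume u: "u \<in> words U n" and v: "v \<in> words U n"
    and eq: "plant B p (map f u) n x = plant B p (map f v) n x"
  have len: "length u = n" "length v = n" using u v by (auto simp: words_def)
  show "u = v"
  proof (rule nth_equalityI)
    fix l assume "l < length u"
    then have l: "l < n" using len by simp
    then have "f (u ! l) = f (v ! l)"
      using plant_map_nth[OF assms(1,2) len(1) l, of f] plant_map_nth[OF assms(1,2) len(2) l, of f] eq by simp
    then show "u ! l = v ! l"
      using inj_onD[OF assms(3)] nth_in_words[OF u l] nth_in_words[OF v l] by blast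
  qed (simp add: len)
qed

text \<open>Arcs go to arcs because changing one letter changes one planted position. Conversely, an
  arc between two images moves in a single coordinate, which has to be a planted one, so it comes
  from a change of a single letter.\<close>

lemma sub_in_plant:
  assumes F: "pair_graph F" and G: "pair_graph G"
    and \<phi>: "inj_on \<phi> (pverts F)" "sub_in ind (relabel \<phi> F) G"
    and p: "p \<in> words {..<B} n" and x: "x \<in> words (pverts G) N" and N: "n * B \<le> N"
  shows "sub_in ind (relabel (\<lambda>u. plant B p (map \<phi> u) n x) (cart_power F n)) (cart_power G N)"
proof -
  interpret F: pair_graph F by fact
  interpret G: pair_graph G by fact
  interpret Fn: pair_graph "cart_power F n" by (rule pair_graph_cart_power[OF F])
  interpret GN: pair_graph "cart_power G N" by (rule pair_graph_cart_power[OF G])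
  define \<psi> where "\<psi> = (\<lambda>u. plant B p (map \<phi> u) n x)"
  have V: "\<phi> ` pverts F \<subseteq> pverts G" and E: "map_prod \<phi> \<phi> ` parcs F \<subseteq> parcs G"
    using \<phi>(2) by (simp_all add: sub_in_iff relabel_def)
  have len: "length x = N" using x by (simp add: words_def)
  have pos: "l * B + p ! l < N" if "l < n" for l
    using block_offset_less[OF that, of "p ! l" B] nth_in_words[OF p that] N by simp
  have nth: "\<psi> u ! (l * B + p ! l) = \<phi> (u ! l)" if "u \<in> words (pverts F) n" "l < n" for u l
    using plant_map_nth[OF p, of x u l \<phi>] that N len by (simp add: \<psi>_def words_def)
  have \<psi>_in: "\<psi> u \<in> words (pverts G) N" if "u \<in> words (pverts F) n" for u
    unfolding \<psi>_def using that V by (intro plant_in_words[OF x, where n = n]) (auto simp: words_def)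
  have "pverts (relabel \<psi> (cart_power F n)) \<subseteq> pverts (cart_power G N)"
    using \<psi>_in by (auto simp: pverts_relabel pverts_cart_power_eq_words)
  moreover have "parcs (relabel \<psi> (cart_power F n)) \<subseteq> parcs (cart_power G N)"
  proof -
    have "(\<psi> u, \<psi> v) \<in> parcs (cart_power G N)" if "(u, v) \<in> parcs (cart_power F n)" for u v
    proof -
      from that obtain l b where u: "u \<in> words (pverts F) n" and l: "l < n"
        and b: "(u ! l, b) \<in> parcs F" and v: "v = u[l := b]"
        by (auto simp: arc_cart_power_iff[OF F.pair_wf_digraph])
      have "\<psi> v = (\<psi> u)[l * B + p ! l := \<phi> b]"
        unfolding \<psi>_def v map_update using u l N len p
        by (intro plant_update_letter) (auto simp: words_def)
      moreover have "(\<psi> u ! (l * B + p ! l), \<phi> b) \<in> parcs G"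
        using E map_prod_imageI[OF b, of \<phi> \<phi>] nth[OF u l] by auto
      ultimately show ?thesis
        unfolding arc_cart_power_iff[OF G.pair_wf_digraph] using \<psi>_in[OF u] pos[OF l] by blast
    qed
    then show ?thesis by (auto simp: relabel_def)
  qed
  moreover have "(\<psi> u, \<psi> v) \<in> parcs (relabel \<psi> (cart_power F n))"
    if ind and u: "u \<in> words (pverts F) n" and v: "v \<in> words (pverts F) n"
      and arc: "(\<psi> u, \<psi> v) \<in> parcs (cart_power G N)" for u v
  proof -
    obtain j b where j: "j < N" "(\<psi> u ! j, b) \<in> parcs G" "\<psi> v = (\<psi> u)[j := b]"
      using arc by (auto simp: arc_cart_power_iff[OF G.pair_wf_digraph])
    have b: "\<psi> v ! j = b"
      using j \<psi>_in[OF u] by (simp add: words_def)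
    then have neq: "\<psi> v ! j \<noteq> \<psi> u ! j"
      using G.pair_no_loops[OF j(2)] by simp
    \<comment> \<open>Off the planted positions both images agree with \<open>x\<close>, whereas an
      arc changes the letter at \<open>j\<close>.\<close>
    have "\<exists>l<n. j = l * B + p ! l"
    proof (rule ccontr)
      assume "\<not> ?thesis"
      then have "\<psi> v ! j = \<psi> u ! j"
        by (simp add: \<psi>_def plant_nth_other)
      with neq show False by simp
    qed
    then obtain l where l: "l < n" "j = l * B + p ! l" by blast
    have ul: "u ! l \<in> pverts F" "v ! l \<in> pverts F"
      using nth_in_words u v l by blast+
    have "(\<phi> (u ! l), \<phi> (v ! l)) \<in> parcs G"
      using j(2) b nth[OF u l(1)] nth[OF v l(1)] l(2) by simp
    then have "(\<phi> (u ! l), \<phi> (v ! l)) \<in> parcs (relabel \<phi> F)"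
      using \<phi>(2) \<open>ind\<close> ul unfolding sub_in_iff pverts_relabel by blast
    then obtain a a' where a: "(a, a') \<in> parcs F" "\<phi> a = \<phi> (u ! l)" "\<phi> a' = \<phi> (v ! l)"
      by (auto simp: relabel_def)
    then have F_arc: "(u ! l, v ! l) \<in> parcs F"
      using inj_onD[OF \<phi>(1)] ul F.wellformed'[OF a(1)] by metis
    \<comment> \<open>The images agree at the planted positions of all other blocks, and
      \<open>\<phi>\<close> is injective.\<close>
    have "v = u[l := v ! l]"
    proof (rule nth_equalityI)
      fix s assume "s < length v"
      then have s: "s < n" using v by (simp add: words_def)
      show "v ! s = u[l := v ! l] ! s"
      proof (cases "s = l")
        case False
        then have "s * B + p ! s \<noteq> j"
          using l s nth_in_words[OF p] by (simp add: block_offset_eq_iff)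
        then have "\<phi> (v ! s) = \<phi> (u ! s)"
          using nth[OF u s] nth[OF v s] j(3) by simp
        then show ?thesis
          using inj_onD[OF \<phi>(1)] nth_in_words[OF u s] nth_in_words[OF v s] False by simp
      qed (use u l in \<open>simp add: words_def\<close>)
    qed (use u v in \<open>simp add: words_def\<close>)
    then have "(u, v) \<in> parcs (cart_power F n)"
      unfolding arc_cart_power_iff[OF F.pair_wf_digraph] using u l F_arc by blast
    from map_prod_imageI[OF this, of \<psi> \<psi>] show ?thesis
      by (simp add: relabel_def)
  qed
  then have "ind \<longrightarrow> (\<forall>u\<in>pverts (relabel \<psi> (cart_power F n)). \<forall>v\<in>pverts (relabel \<psi> (cart_power F n)).
      (u, v) \<in> parcs (cart_power G N) \<longrightarrow> (u, v) \<in> parcs (relabel \<psi> (cart_power F n)))"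
    unfolding pverts_relabel pverts_cart_power_eq_words by blast
  moreover have "pair_wf_digraph (relabel \<psi> (cart_power F n))"
    by (rule pair_wf_digraph_relabel) (rule Fn.pair_wf_digraph)
  ultimately show ?thesis
    unfolding sub_in_iff \<psi>_def[symmetric] using GN.pair_wf_digraph by - (intro conjI; assumption)
qed

section \<open>Slice density and arrow relations\<close>

text \<open>Translates a count of pairs \<open>(l, v)\<close> into a count of slices. If
  \<open>F\<close> has at least two vertices, each slice comes from exactly
  \<open>card (pverts F)\<close> pairs, one for each choice of \<open>v ! l\<close>, so fractions
  agree.\<close>

lemma contains_slice_fraction_induced_on:
  assumes F: "pair_graph F" "pverts F \<noteq> {}" and n: "n \<ge> 1" and \<epsilon>: "0 < \<epsilon>" "\<epsilon> \<le> 1"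
    and X: "X \<subseteq> words (pverts F) n"
    and dense: "\<epsilon> * (real n * real (card (pverts F)) ^ n) \<le>
      real (card {(l, v). l < n \<and> v \<in> words (pverts F) n \<and> (\<forall>a\<in>pverts F. v[l := a] \<in> X)})"
  shows "contains_slice_fraction \<epsilon> F n (induced_on (cart_power F n) X)"
proof -
  interpret F: pair_graph F by fact
  interpret Fn: pair_graph "cart_power F n" by (rule pair_graph_cart_power[OF F(1)])
  let ?U = "pverts F" and ?K = "induced_on (cart_power F n) X"
  define good where "good = {(l, v). l < n \<and> v \<in> words ?U n \<and> (\<forall>a\<in>?U. v[l := a] \<in> X)}"
  define \<sigma> where "\<sigma> = (\<lambda>(l, v). with_proj (cart_power F n) \<restriction> ((\<lambda>a. v[l := a]) ` ?U))"
  let ?S = "{S \<in> slices F n. subgraph S ?K}"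
  have \<sigma>_good: "\<sigma> ` good \<subseteq> ?S"
  proof
    fix S assume "S \<in> \<sigma> ` good"
    then obtain l v where lv: "l < n" "v \<in> words ?U n" "\<And>a. a \<in> ?U \<Longrightarrow> v[l := a] \<in> X"
      and S: "S = with_proj (cart_power F n) \<restriction> ((\<lambda>a. v[l := a]) ` ?U)"
      by (auto simp: good_def \<sigma>_def)
    have "(\<lambda>a. v[l := a]) = (\<lambda>a. take l v @ a # drop (Suc l) v)"
      using lv by (auto simp: words_def upd_conv_take_nth_drop)
    then have "S = with_proj (cart_power F n) \<restriction> ((\<lambda>a. take l v @ a # drop (Suc l) v) ` ?U)"
      using S by simp
    moreover have "set (take l v) \<subseteq> ?U" "set (drop (Suc l) v) \<subseteq> ?U"
      "length (take l v) + length (drop (Suc l) v) + 1 = n"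
      using lv by (auto simp: words_def dest: in_set_takeD in_set_dropD)
    ultimately have "S \<in> slices F n"
      unfolding slices_def by blast
    moreover have "subgraph S ?K"
    proof -
      have "pair_wf_digraph ?K"
        by (auto simp: pair_wf_digraph_def induced_on_def)
      moreover have "wf_digraph S"
        unfolding S by unfold_locales auto
      ultimately show ?thesis
        using lv(3) by (auto simp: subgraph_def wf_digraph_wp_iff compatible_def S induced_on_def)
    qed
    ultimately show "S \<in> ?S" by simp
  qed
  have "slices F n \<subseteq> (\<lambda>X. with_proj (cart_power F n) \<restriction> X) ` Pow (pverts (cart_power F n))"
    by (force simp: slices_def pverts_cart_power)
  then have fin: "finite (slices F n)"
    by (rule finite_subset) simp
  then have finS: "finite ?S" by simp
  have U_pos: "card ?U > 0"
    using F by (simp add: card_gt_0_iff)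
  have dense': "\<epsilon> * (real n * real (card ?U) ^ n) \<le> real (card good)"
    using dense by (simp add: good_def)
  show ?thesis
  proof (cases "card ?U \<ge> 2")
    case True
    \<comment> \<open>With two vertices available, a slice determines its direction \<open>l\<close>.\<close>
    let ?h = "\<lambda>(l, v). (\<sigma> (l, v), v ! l)"
    have "inj_on ?h good"
    proof (rule inj_onI)
      fix g g' assume gg: "g \<in> good" "g' \<in> good" "?h g = ?h g'"
      obtain l v where g: "g = (l, v)" by (cases g)
      obtain l' v' where g': "g' = (l', v')" by (cases g')
      have lv: "l < n" "l' < n" "v \<in> words ?U n" "v' \<in> words ?U n"
        using gg by (auto simp: g g' good_def)
      have len: "length v = n" "length v' = n" using lv by (auto simp: words_def)
      have eq: "\<sigma> (l, v) = \<sigma> (l', v')" and letter: "v ! l = v' ! l'"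
        using gg(3) by (auto simp: g g')
      have img: "(\<lambda>a. v[l := a]) ` ?U = (\<lambda>a. v'[l' := a]) ` ?U"
        using arg_cong[OF eq, of verts] by (simp add: \<sigma>_def)
      have ex: "\<exists>b\<in>?U. v[l := a] = v'[l' := b]" if "a \<in> ?U" for a
        using img that by blast
      obtain b where b: "v = v'[l' := b]"
        using ex[OF nth_in_words[OF lv(3,1)]] by auto
      show "g = g'"
      proof (cases "l = l'")
        case True
        then show ?thesis using b letter len lv g g' by auto
      next
        case False
        have "\<not> ?U \<subseteq> {v ! l}"
          using \<open>card ?U \<ge> 2\<close> card_mono[of "{v ! l}" ?U] by auto
        then obtain a where a: "a \<in> ?U" "a \<noteq> v ! l" by blast
        obtain c where c: "v[l := a] = v'[l' := c]" using ex[OF a(1)] by blast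
        have "a = v' ! l" using arg_cong[OF c, of "\<lambda>w. w ! l"] False lv len by simp
        moreover have "v ! l = v' ! l" using arg_cong[OF b, of "\<lambda>w. w ! l"] False by simp
        ultimately show ?thesis using a by simp
      qed
    qed
    moreover have "?h ` good \<subseteq> ?S \<times> ?U"
      using \<sigma>_good by (auto simp: good_def nth_in_words)
    ultimately have "card good \<le> card (?S \<times> ?U)"
      using finS by (intro card_inj_on_le[where f = ?h]) auto
    then have "real (card good) \<le> real (card ?S * card ?U)"
      unfolding card_cartesian_product by (rule of_nat_mono)
    \<comment> \<open>A slice fixes only \<open>n - 1\<close> letters; the remaining factor counts
      the free letter \<open>v ! l\<close>.\<close>
    moreover have "real n * real (card ?U) ^ n = real (card (slices F n)) * real (card ?U)"
      using n power_minus_mult[of n "real (card ?U)"] by (simp add: card_slices[OF F(1) True])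
    ultimately have "\<epsilon> * real (card (slices F n)) * real (card ?U) \<le> real (card ?S) * real (card ?U)"
      using dense' unfolding of_nat_mult by (simp only: mult.assoc)
    then show ?thesis
      using U_pos by (simp add: contains_slice_fraction_def)
  next
    case False
    then have "card ?U = 1" using U_pos by linarith
    then obtain a where a: "?U = {a}" by (auto simp: card_1_singleton_iff)
    \<comment> \<open>For a one-vertex graph all slices coincide, so a single good pair together
      with \<open>\<epsilon> \<le> 1\<close> suffices.\<close>
    have "slices F n \<subseteq> {with_proj (cart_power F n) \<restriction> {replicate n a}}"
    proof
      fix S assume "S \<in> slices F n"
      then obtain us vs where S: "S = with_proj (cart_power F n) \<restriction> ((\<lambda>x. us @ x # vs) ` ?U)"
        "set us \<subseteq> {a}" "set vs \<subseteq> {a}" "length us + length vs + 1 = n"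
        by (auto simp: slices_def a)
      have "us @ a # vs = replicate n a"
        using S by (intro replicate_eqI) auto
      then show "S \<in> {with_proj (cart_power F n) \<restriction> {replicate n a}}"
        by (simp add: S(1) a)
    qed
    from card_mono[OF _ this] have "card (slices F n) \<le> 1" by simp
    then have "\<epsilon> * real (card (slices F n)) \<le> 1 * 1"
      using \<epsilon> by (intro mult_mono) auto
    moreover have "0 < \<epsilon> * (real n * real (card ?U) ^ n)"
      using \<epsilon>(1) n U_pos by simp
    then have "card good \<noteq> 0"
      using dense' by (metis of_nat_0 not_le)
    then have "good \<noteq> {}" by auto
    then have "?S \<noteq> {}" using \<sigma>_good by blast
    then have "1 \<le> card ?S" using finS by (simp add: Suc_le_eq card_gt_0_iff)
    ultimately show ?thesis
      unfolding contains_slice_fraction_def by linarith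
  qed
qed

section \<open>Monochromatic copies in large powers\<close>

definition slice_density_zero :: "bool \<Rightarrow> 'a pair_pre_digraph \<Rightarrow> 'b pair_pre_digraph \<Rightarrow> bool" where
  "slice_density_zero ind G H \<longleftrightarrow>
    (\<forall>\<epsilon>>0. \<exists>N0. \<forall>N\<ge>N0. \<forall>K.
      pair_graph K \<and> subgraph K (cart_power G N) \<and> contains_slice_fraction \<epsilon> G N K \<longrightarrow>
      (\<exists>C. copy_in ind C H K))"

definition vertex_arrows :: "bool \<Rightarrow> nat \<Rightarrow> 'a pair_pre_digraph \<Rightarrow> 'b pair_pre_digraph set \<Rightarrow> bool" where
  "vertex_arrows ind r G \<F> \<longleftrightarrow>
    (\<forall>c \<in> pverts G \<rightarrow> {1..r}. \<exists>H\<in>\<F>. \<exists>C. copy_in ind C H G \<and> (\<exists>k\<in>{1..r}. \<forall>v\<in>pverts C. c v = k))"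

text \<open>Large powers of a graph without vertices have no slices, so even their empty subgraph
  meets the slice condition and contains a copy of \<open>H\<close>. Thus \<open>H\<close> has no
  vertices either, and its copy is monochromatic in any colouring.\<close>

lemma vertex_arrows_of_null_graph:
  assumes r: "r \<ge> 1" and F: "pverts F = {}" and dens: "slice_density_zero ind F H"
    and FG: "pair_graph F" "pair_graph G" and H: "H \<in> \<F>"
  shows "vertex_arrows ind r (cart_power G N) \<F>"
proof -
  interpret GN: pair_graph "cart_power G N" by (rule pair_graph_cart_power[OF FG(2)])
  obtain N0 where N0: "\<And>N K. N \<ge> N0 \<Longrightarrow> pair_graph K \<Longrightarrow> subgraph K (cart_power F N) \<Longrightarrow>
      contains_slice_fraction 1 F N K \<Longrightarrow> \<exists>C. copy_in ind C H K"
    using dens unfolding slice_density_zero_def by (metis zero_less_one)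
  \<comment> \<open>From exponent 2 on, a slice needs a vertex for a fixed coordinate; at exponent 1
    there is still the empty slice.\<close>
  let ?M = "max N0 2"
  let ?K = "induced_on (cart_power F ?M) {}"
  have "slices F ?M = {}"
    using F by (auto simp: slices_def)
  then have "contains_slice_fraction 1 F ?M ?K"
    by (simp add: contains_slice_fraction_def)
  moreover have "pair_graph ?K" "subgraph ?K (cart_power F ?M)"
    using pair_graph_induced_on[OF pair_graph_cart_power[OF FG(1)], of "{}" ?M]
      sub_in_induced_on[of "cart_power F ?M" "{}" False] pair_graph_cart_power[OF FG(1), of ?M]
    by (simp_all add: sub_in_def pair_graph_def pair_digraph_def pair_fin_digraph_def)
  ultimately obtain C where C: "copy_in ind C H ?K"
    using N0[of ?M ?K] by auto
  \<comment> \<open>A default value: the map acts on an empty vertex set.\<close>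
  let ?f = "\<lambda>_. []"
  have "sub_in ind (relabel ?f ?K) (cart_power G N)"
    by (auto simp: sub_in_iff relabel_def induced_on_def pair_wf_digraph_def dest: GN.wellformed')
  then have "copy_in ind (relabel ?f C) H (cart_power G N)"
    by (intro copy_in_relabel[OF C]) (simp_all add: induced_on_def)
  moreover have "pverts (relabel ?f C) = {}"
    using C by (simp add: copy_in_iff sub_in_iff induced_on_def pverts_relabel)
  ultimately show ?thesis
    unfolding vertex_arrows_def using r H
    by (metis atLeastAtMost_iff empty_iff order_refl)
qed

text \<open>Both halves of the theorem at once. The constants are chosen in the order
  \<open>M\<close>, \<open>\<epsilon>\<close>, \<open>n\<close>, \<open>\<eta>\<close>,
  \<open>B\<close>, none depending on \<open>N\<close>, and \<open>n * B\<close> is the threshold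
  for \<open>N\<close>.\<close>

lemma vertex_arrows_cart_power:
  fixes Gs :: "nat \<Rightarrow> 'a pair_pre_digraph" and Hs :: "nat \<Rightarrow> 'b pair_pre_digraph"
    and G :: "'c pair_pre_digraph"
  assumes r: "r \<ge> 1" and Gs: "\<And>i. i \<in> I \<Longrightarrow> pair_graph (Gs i)" and G: "pair_graph G"
    and I: "finite I"
    and dens: "\<And>i. i \<in> I \<Longrightarrow> slice_density_zero ind (Gs i) (Hs i)"
    and arr: "vertex_arrows ind r G (Gs ` I)"
  shows "\<exists>N0. \<forall>N\<ge>N0. vertex_arrows ind r (cart_power G N) (Hs ` I)"
proof (cases "\<exists>i\<in>I. pverts (Gs i) = {}")
  case True
  then show ?thesis
    using vertex_arrows_of_null_graph[OF r _ dens Gs G] by blast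
next
  case False
  interpret G: pair_graph G by fact
  let ?V = "pverts G"
  define T where "T = {(i, C, k). i \<in> I \<and> copy_in ind C (Gs i) G \<and> k \<in> {1..r}}"
  define U where "U = (\<lambda>(i, C :: 'c pair_pre_digraph, k :: nat). pverts (Gs i))"
  have type_ex: "\<exists>t\<in>T. \<forall>a\<in>pverts (fst (snd t)). d a = snd (snd t)" if d: "d \<in> ?V \<rightarrow> {1..r}" for d
  proof -
    have "\<exists>H\<in>Gs ` I. \<exists>C. copy_in ind C H G \<and> (\<exists>k\<in>{1..r}. \<forall>v\<in>pverts C. d v = k)"
      using arr d unfolding vertex_arrows_def by blast
    then obtain i C k where "i \<in> I" "copy_in ind C (Gs i) G" "k \<in> {1..r}" "\<forall>v\<in>pverts C. d v = k"
      by blast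
    then show ?thesis
      unfolding T_def by (intro bexI[of _ "(i, C, k)"]) auto
  qed
  \<comment> \<open>The copy in a type is determined by a set of vertices and a set of arcs of
    \<open>G\<close>.\<close>
  have finT: "finite T"
  proof (rule finite_subset)
    show "T \<subseteq> I \<times> (\<lambda>(A, E). \<lparr>pverts = A, parcs = E\<rparr>) ` (Pow ?V \<times> Pow (parcs G)) \<times> {1..r}"
    proof
      fix t assume "t \<in> T"
      moreover obtain i C k where t: "t = (i, C, k)" by (cases t)
      ultimately have C: "pverts C \<subseteq> ?V" "parcs C \<subseteq> parcs G" and "i \<in> I" "k \<in> {1..r}"
        by (auto simp: T_def copy_in_iff sub_in_iff)
      have "C = (\<lambda>(A, E). \<lparr>pverts = A, parcs = E\<rparr>) (pverts C, parcs C)" by simp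
      moreover have "(pverts C, parcs C) \<in> Pow ?V \<times> Pow (parcs G)" using C by blast
      ultimately have "C \<in> (\<lambda>(A, E). \<lparr>pverts = A, parcs = E\<rparr>) ` (Pow ?V \<times> Pow (parcs G))"
        by (rule image_eqI)
      then show "t \<in> I \<times> (\<lambda>(A, E). \<lparr>pverts = A, parcs = E\<rparr>) ` (Pow ?V \<times> Pow (parcs G)) \<times> {1..r}"
        using \<open>i \<in> I\<close> \<open>k \<in> {1..r}\<close> by (simp only: t mem_Sigma_iff simp_thms)
    qed
  qed (use I in simp)
  \<comment> \<open>The constant colouring with colour 1 is admissible as \<open>r \<ge> 1\<close>,
    and it yields a type.\<close>
  have T: "T \<noteq> {}"
    using type_ex[of "\<lambda>_. 1"] r by auto
  have "\<forall>t\<in>T. \<exists>f. inj_on f (U t) \<and> fst (snd t) = relabel f (Gs (fst t))"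
    by (auto simp: T_def U_def copy_in_iff)
  from bchoice[OF this] obtain \<phi> where \<phi>: "\<And>t. t \<in> T \<Longrightarrow> inj_on (\<phi> t) (U t)"
      "\<And>t. t \<in> T \<Longrightarrow> fst (snd t) = relabel (\<phi> t) (Gs (fst t))"
    by blast
  have UT: "finite (U t)" "U t \<noteq> {}" "\<phi> t ` U t \<subseteq> ?V" "U t = pverts (Gs (fst t))"
      "sub_in ind (relabel (\<phi> t) (Gs (fst t))) G" "fst t \<in> I" "snd (snd t) \<in> {1..r}" if "t \<in> T" for t
  proof -
    obtain i C k where t: "t = (i, C, k)" by (cases t)
    have i: "i \<in> I" "sub_in ind C G" "k \<in> {1..r}" using that by (auto simp: t T_def copy_in_iff)
    interpret pair_graph "Gs i" by (rule Gs[OF i(1)])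
    show "finite (U t)" "U t \<noteq> {}" "U t = pverts (Gs (fst t))" "fst t \<in> I" "snd (snd t) \<in> {1..r}"
      using False i by (simp_all add: t U_def)
    show sub: "sub_in ind (relabel (\<phi> t) (Gs (fst t))) G"
      using \<phi>(2)[OF that] i(2) by (simp add: t)
    show "\<phi> t ` U t \<subseteq> ?V"
      using sub by (simp add: sub_in_iff pverts_relabel t U_def)
  qed
  obtain t0 where "t0 \<in> T" using T by blast
  with UT(2,3)[of t0] have V: "finite ?V" "?V \<noteq> {}"
    by auto
  define M where "M = real (card T)"
  have M: "M \<ge> 1"
    using T finT by (simp add: M_def Suc_le_eq card_gt_0_iff)
  define \<epsilon> where "\<epsilon> = 1 / (2 * M)"
  have \<epsilon>: "0 < \<epsilon>" "\<epsilon> \<le> 1" using M by (auto simp: \<epsilon>_def)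
  have "\<forall>i\<in>I. \<exists>N0. \<forall>N\<ge>N0. \<forall>K. pair_graph K \<and> subgraph K (cart_power (Gs i) N) \<and>
      contains_slice_fraction \<epsilon> (Gs i) N K \<longrightarrow> (\<exists>C. copy_in ind C (Hs i) K)"
    using dens \<epsilon>(1) unfolding slice_density_zero_def by blast
  from bchoice[OF this] obtain N0 where N0: "\<And>i N K. i \<in> I \<Longrightarrow> N \<ge> N0 i \<Longrightarrow> pair_graph K \<Longrightarrow>
      subgraph K (cart_power (Gs i) N) \<Longrightarrow> contains_slice_fraction \<epsilon> (Gs i) N K \<Longrightarrow>
      \<exists>C. copy_in ind C (Hs i) K"
    by blast
  \<comment> \<open>The sum bounds all thresholds \<open>N0 i\<close>; the successor makes
    \<open>n\<close> positive, so that division by \<open>n\<close> is safe.\<close>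
  define n where "n = Suc (sum N0 I)"
  have n: "N0 i \<le> n" if "i \<in> I" for i
    using member_le_sum[of i I N0] that I by (simp add: n_def)
  have n_pos: "n > 0" by (simp add: n_def)
  define \<eta> where "\<eta> = \<epsilon> / real n"
  have \<eta>: "\<eta> > 0" "real n * \<eta> \<le> 1 / (2 * real (card T))"
    using \<epsilon>(1) n_pos by (simp_all add: \<eta>_def flip: M_def \<epsilon>_def)
  \<comment> \<open>Blocks long enough for the second moment bound with loss \<open>\<eta>\<close>
    per letter.\<close>
  obtain B where B: "real (card ?V) / \<eta>\<^sup>2 < real B"
    using reals_Archimedean2 by blast
  then have B_pos: "B > 0"
    using \<eta>(1) by (metis divide_nonneg_nonneg gr0I not_le of_nat_0 of_nat_0_le_iff zero_le_power2)
  have B_ge: "real (card ?V) \<le> \<eta>\<^sup>2 * real B"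
    using B \<eta>(1) by (simp add: field_simps)
  have "vertex_arrows ind r (cart_power G N) (Hs ` I)" if N: "N \<ge> n * B" for N
    unfolding vertex_arrows_def
  proof
    fix c assume "c \<in> pverts (cart_power G N) \<rightarrow> {1..r}"
    then have c: "c x \<in> {1..r}" if "x \<in> words ?V N" for x
      using that by (auto simp: pverts_cart_power_eq_words)
    define type_of where "type_of d = (SOME t. t \<in> T \<and> (\<forall>a\<in>pverts (fst (snd t)). d a = snd (snd t)))"
      for d :: "'c \<Rightarrow> nat"
    have type_of: "type_of d \<in> T" "\<And>a. a \<in> pverts (fst (snd (type_of d))) \<Longrightarrow> d a = snd (snd (type_of d))"
      if "d \<in> ?V \<rightarrow> {1..r}" for d
    proof -
      have "\<exists>t. t \<in> T \<and> (\<forall>a\<in>pverts (fst (snd t)). d a = snd (snd t))"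
        using type_ex[OF that] by blast
      from someI_ex[OF this] show "type_of d \<in> T"
        "\<And>a. a \<in> pverts (fst (snd (type_of d))) \<Longrightarrow> d a = snd (snd (type_of d))"
        unfolding type_of_def[symmetric] by blast+
    qed
    \<comment> \<open>The slice through \<open>x\<close> in direction \<open>j\<close> is read as a
      colouring of \<open>G\<close>. It does not depend on the letter of \<open>x\<close> at
      \<open>j\<close>, which is the invariance that planting needs.\<close>
    define \<tau> where "\<tau> j x = type_of (\<lambda>a. c (x[j := a]))" for j x
    have slice: "(\<lambda>a. c (x[j := a])) \<in> ?V \<rightarrow> {1..r}" if "x \<in> words ?V N" for x j
      using c update_in_words[OF that] by blast
    have \<tau>: "\<tau> j (x[j := b]) = \<tau> j x" for j x b
      by (simp add: \<tau>_def)
    have \<tau>_in: "\<tau> j x \<in> T" if "j < N" "x \<in> words ?V N" for j x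
      unfolding \<tau>_def by (rule type_of(1)[OF slice[OF that(2)]])
    have "\<exists>t\<in>T. \<exists>p\<in>words {..<B} n. \<exists>x\<in>words ?V N.
        1 / (2 * real (card T)) * (real n * real (card (U t)) ^ n) \<le> real (card {(l, v).
        l < n \<and> v \<in> words (U t) n \<and> \<tau> (l * B + p ! l) (plant B p (map (\<phi> t) v) n x) = t})"
      using finT T V UT(1,3) N B_pos \<tau> \<tau>_in \<eta>(1) B_ge \<eta>(2) by (rule dense_planting)
    then obtain t p x where t: "t \<in> T" and p: "p \<in> words {..<B} n" and x: "x \<in> words ?V N"
      and dense: "1 / (2 * real (card T)) * (real n * real (card (U t)) ^ n) \<le> real (card {(l, v).
        l < n \<and> v \<in> words (U t) n \<and> \<tau> (l * B + p ! l) (plant B p (map (\<phi> t) v) n x) = t})"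
      by blast
    define i k where "i = fst t" and "k = snd (snd t)"
    note Ut = UT[OF t, folded i_def k_def]
    define \<psi> where "\<psi> = (\<lambda>u. plant B p (map (\<phi> t) u) n x)"
    \<comment> \<open>The part of the power of \<open>Gs i\<close> that \<open>\<psi>\<close> sends
      into colour class \<open>k\<close>.\<close>
    define X where "X = {u \<in> words (U t) n. c (\<psi> u) = k}"
    let ?P = "cart_power (Gs i) n"
    let ?K = "induced_on ?P X"
    have len: "length x = N" using x by (simp add: words_def)
    have graph_i: "pair_graph (Gs i)" by (rule Gs[OF Ut(6)])
    interpret P: pair_graph ?P by (rule pair_graph_cart_power[OF graph_i])
    have X: "X \<subseteq> words (pverts (Gs i)) n" "X \<subseteq> pverts ?P"
      using Ut(4) by (auto simp: X_def pverts_cart_power_eq_words)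
    have \<psi>_in: "\<psi> u \<in> words ?V N" if "u \<in> words (U t) n" for u
      unfolding \<psi>_def using that Ut(3) by (intro plant_in_words[OF x, where n = n]) (auto simp: words_def)
    \<comment> \<open>If the slice through \<open>\<psi> v\<close> has type \<open>t\<close>, its
      vertices over the copy have colour \<open>k\<close>, and these are the images of the words
      \<open>v[l := a]\<close>.\<close>
    have good: "v[l := a] \<in> X"
      if l: "l < n" and v: "v \<in> words (U t) n" and type: "\<tau> (l * B + p ! l) (\<psi> v) = t" and a: "a \<in> U t" for l v a
    proof -
      have "\<psi> (v[l := a]) = (\<psi> v)[l * B + p ! l := \<phi> t a]"
        unfolding \<psi>_def map_update using p N len l v
        by (intro plant_update_letter) (auto simp: words_def)
      moreover have "\<phi> t a \<in> pverts (fst (snd t))"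
        using a \<phi>(2)[OF t] Ut(4) by (simp add: pverts_relabel i_def)
      then have "c ((\<psi> v)[l * B + p ! l := \<phi> t a]) = k"
        using type_of(2)[OF slice[OF \<psi>_in[OF v]], of "\<phi> t a" "l * B + p ! l"] type
        by (simp add: \<tau>_def k_def)
      ultimately show ?thesis
        using update_in_words[OF v a] by (simp add: X_def)
    qed
    have "contains_slice_fraction \<epsilon> (Gs i) n ?K"
    proof (rule contains_slice_fraction_induced_on[OF graph_i _ _ \<epsilon> X(1)])
      let ?A = "{(l, v). l < n \<and> v \<in> words (U t) n \<and> \<tau> (l * B + p ! l) (\<psi> v) = t}"
      let ?A' = "{(l, v). l < n \<and> v \<in> words (pverts (Gs i)) n \<and> (\<forall>a\<in>pverts (Gs i). v[l := a] \<in> X)}"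
      have "finite ({..<n} \<times> words (pverts (Gs i)) n)"
        using Ut(1,4) by (simp add: finite_words)
      then have "finite ?A'"
        by (rule rev_finite_subset) auto
      moreover have "?A \<subseteq> ?A'"
        using good Ut(4) by auto
      ultimately have "card ?A \<le> card ?A'"
        by (rule card_mono)
      then show "\<epsilon> * (real n * real (card (pverts (Gs i))) ^ n) \<le> real (card ?A')"
        using dense Ut(4) unfolding \<epsilon>_def M_def \<psi>_def by simp
    qed (use Ut(2,4) in \<open>simp_all add: n_def\<close>)
    moreover have "pair_graph ?K" "subgraph ?K ?P"
      using pair_graph_induced_on[OF P.pair_graph X(2)] sub_in_induced_on[OF P.pair_wf_digraph X(2), of False]
      by (simp_all add: sub_in_def)
    ultimately obtain D where D: "copy_in ind D (Hs i) ?K"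
      using N0[OF Ut(6) n[OF Ut(6)]] by blast
    have inj: "inj_on \<psi> (pverts ?P)"
      unfolding \<psi>_def pverts_cart_power_eq_words
      using inj_on_plant_map[OF p, of x "\<phi> t" "pverts (Gs i)"] \<phi>(1)[OF t] Ut(4) N len by simp
    have "sub_in ind (relabel \<psi> ?P) (cart_power G N)"
      unfolding \<psi>_def using \<phi>(1)[OF t] Ut(4,5) p x N by (intro sub_in_plant[OF graph_i G]) simp_all
    \<comment> \<open>\<open>?K\<close> is induced in the power of \<open>Gs i\<close>, so the
      embedding \<open>\<psi>\<close> of that power restricts to \<open>?K\<close> in the induced
      case as well.\<close>
    then have sub: "sub_in ind (relabel \<psi> ?K) (cart_power G N)"
      by (rule sub_in_relabel[OF sub_in_induced_on[OF P.pair_wf_digraph X(2)] inj])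
    have "inj_on \<psi> (pverts ?K)"
      using inj_on_subset[OF inj X(2)] by (simp add: induced_on_def)
    with D have copy: "copy_in ind (relabel \<psi> D) (Hs i) (cart_power G N)"
      using sub by (rule copy_in_relabel)
    have "pverts D \<subseteq> X"
      using D by (simp add: copy_in_iff sub_in_iff induced_on_def)
    then have mono: "\<forall>v\<in>pverts (relabel \<psi> D). c v = k"
      by (auto simp: pverts_relabel X_def)
    show "\<exists>H\<in>Hs ` I. \<exists>C. copy_in ind C H (cart_power G N) \<and>
        (\<exists>k\<in>{1..r}. \<forall>v\<in>pverts C. c v = k)"
      by (intro bexI[of _ "Hs i"] exI[of _ "relabel \<psi> D"] conjI bexI[of _ k] copy mono imageI Ut(6,7))
  qed
  then show ?thesis by blast
qed

lemma vertex_arrows_eq: "vertex_arrows False = arrows" "vertex_arrows True = induced_arrows"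
  by (simp_all add: fun_eq_iff vertex_arrows_def arrows_def induced_arrows_def copy_in_def)

lemma slice_density_zero_eq:
  "slice_density_zero False = zero_slice_density"
  "slice_density_zero True = zero_induced_slice_density"
  by (simp_all add: fun_eq_iff slice_density_zero_def zero_slice_density_def
      zero_induced_slice_density_def copy_in_def)

theorem theorem1p2:
  fixes r m :: nat
    and Gs :: "nat \<Rightarrow> 'a pair_pre_digraph"
    and Hs :: "nat \<Rightarrow> 'b pair_pre_digraph"
    and G :: "'c pair_pre_digraph"
  assumes "r \<ge> 1"
    and "\<And>i. i \<in> {1..m} \<Longrightarrow> pair_graph (Gs i)"
    and "\<And>i. i \<in> {1..m} \<Longrightarrow> pair_graph (Hs i)"
    and "pair_graph G"
  shows "((\<forall>i\<in>{1..m}. zero_slice_density (Gs i) (Hs i)) \<and> arrows r G (Gs ` {1..m}) \<longrightarrow>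
           (\<exists>N0. \<forall>N\<ge>N0. arrows r (cart_power G N) (Hs ` {1..m}))) \<and>
         ((\<forall>i\<in>{1..m}. zero_induced_slice_density (Gs i) (Hs i)) \<and>
           induced_arrows r G (Gs ` {1..m}) \<longrightarrow>
           (\<exists>N0. \<forall>N\<ge>N0. induced_arrows r (cart_power G N) (Hs ` {1..m})))"
proof -
  have "\<exists>N0. \<forall>N\<ge>N0. vertex_arrows ind r (cart_power G N) (Hs ` {1..m})"
    if "\<forall>i\<in>{1..m}. slice_density_zero ind (Gs i) (Hs i)" "vertex_arrows ind r G (Gs ` {1..m})" for ind
    using that by (intro vertex_arrows_cart_power[OF assms(1,2,4)]) auto
  from this[of False] this[of True] show ?thesis
    unfolding vertex_arrows_eq slice_density_zero_eq by blast
qed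

end
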